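(* In the Bayesian $k$-armed bandit problem described in the context, suppose the prior $\Gamma$ is $1$-regular and every $P_\mu$ is $1$-subgaussian, and Seq-Greedy is executed with parameter $\upsilon=2\delta$. Then: (i) for Bernoulli rewards ($P_\mu$ Bernoulli with mean $\mu$) and $\delta=\tilde\Theta(\max(k^{-1},T^{-1/2}))$, $BR_{T,k}(\text{Seq-Greedy})\le\tilde O(\max[\sqrt T,T/k])$; (ii) for general $1$-subgaussian rewards and $\delta=\tilde\Theta(\max(k^{-1/3},T^{-1/4}))$, $BR_{T,k}(\text{Seq-Greedy})\le\tilde O(\max[T^{3/4},T/k^{1/3}])$; (iii) for uniformly upward-looking reward families and $\delta=\tilde\Theta(\max(k^{-1/2},T^{-1/3}))$, $BR_{T,k}(\text{Seq-Greedy})\le\tilde O(\max[T^{2/3},T/k^{1/2}])$.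
   Context: Bayesian $k$-armed bandit: horizon $T$, arms $[k]$, family $\mathcal{F}=\{P_\mu:\mu\in[0,1]\}$ with $P_\mu$ of mean $\mu$; prior $\Gamma$ on $[0,1]$ with density; means i.i.d. $\sim\Gamma$; pulling arm $i$ at time $t$ gives $Y_{it}\sim P_{\mu_i}$ independently, only the pulled reward observed. $R_T(\pi\mid\bm\mu)=T\max_i\mu_i-\sum_t\mathbb{E}[\mu_{a_t}\mid\pi]$, $BR_{T,k}(\pi)=\mathbb{E}[R_T(\pi\mid\bm\mu)]$. $1$-regular: there are $0<c_0<C_0$ with $c_0\epsilon\le\mathbb{P}_\Gamma(\mu>1-\epsilon)\le\mathbb{P}_\Gamma(\mu\ge1-\epsilon)\le C_0\epsilon$ for $\epsilon\in(0,1]$. $1$-subgaussian: $\mathbb{E}[e^{s(Z-\mu)}]\le e^{s^2/2}$ for $Z\sim P_\mu$. A distribution $Q$ of mean $\mu$ with $Q-\mu$ $1$-subgaussian is upward-looking with parameter $p_0$ if, with $X_i$ i.i.d. $\sim Q$, $R_n(\theta)=\sum_{i\le n}X_i-n\theta$, $\tau(\theta)=\inf\{n\ge1:R_n(\theta)<0\text{ or }R_n(\theta)\ge1\}$, for every $\theta<\mu$ either $\mathbb{P}[R_{\tau(\theta)}(\theta)\ge1]\ge p_0$ or $\mathbb{E}[(X_1-\theta)\mathbf 1(X_1\ge\theta)]\ge p_0$; $\mathcal{F}$ is uniformly upward-looking with parameters $(p_0,\delta_0)$ if $P_\mu$ is upward-looking with parameter $p_0$ for all $\mu\ge1-\delta_0$.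 Seq-Greedy with input $\upsilon$: set $i=1$, pull arm 1 at $t=1$; for $t\ge2$: if the empirical mean $\hat\mu_i(t-1)\ge1-\upsilon$ pull arm $i$; else if $i<k$ pull arm $i+1$ and set $i\leftarrow i+1$; else pull $\arg\max_j\hat\mu_j(t-1)$. $\tilde O,\tilde\Theta$ hide polylogarithmic factors and constants. *)

theory Defs
  imports "HOL-Probability.Probability"
begin

text \<open>A reward family: for each mean mu in [0,1] a Borel probability measure on the reals
  with mean mu; measurable as a kernel in mu (needed for the Bayesian regret to be defined).\<close>
definition reward_family :: "(real \<Rightarrow> real measure) \<Rightarrow> bool" where
  "reward_family P \<longleftrightarrow>
     (\<forall>\<mu>\<in>{0..1}. prob_space (P \<mu>) \<and> sets (P \<mu>) = sets borel \<and>
        integrable (P \<mu>) (\<lambda>x. x) \<and> (\<integral>x. x \<partial>P \<mu>) = \<mu>) \<and>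
     P \<in> measurable (restrict_space borel {0..1}) (subprob_algebra borel)"

definition subgaussian1 :: "real measure \<Rightarrow> real \<Rightarrow> bool" where
  "subgaussian1 Q \<mu> \<longleftrightarrow>
     (\<forall>s::real. integrable Q (\<lambda>x. exp (s * (x - \<mu>))) \<and>
        (\<integral>x. exp (s * (x - \<mu>)) \<partial>Q) \<le> exp (s\<^sup>2 / 2))"

definition bernoulli_family :: "real \<Rightarrow> real measure" where
  "bernoulli_family \<mu> = distr (measure_pmf (bernoulli_pmf \<mu>)) borel (\<lambda>b. if b then 1 else 0)"

definition walk :: "(nat \<Rightarrow> real) \<Rightarrow> real \<Rightarrow> nat \<Rightarrow> real" where
  "walk X \<theta> n = (\<Sum>i<n. X i) - real n * \<theta>"

text \<open>Probability that R exits [0,1) upward at time tau(theta), i.e. P[R_tau >= 1].\<close>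
definition exit_up_prob :: "real measure \<Rightarrow> real \<Rightarrow> real" where
  "exit_up_prob Q \<theta> =
     measure (PiM UNIV (\<lambda>_::nat. Q))
       {X \<in> space (PiM UNIV (\<lambda>_::nat. Q)).
          \<exists>n\<ge>1. walk X \<theta> n \<ge> 1 \<and>
                 (\<forall>m. 1 \<le> m \<longrightarrow> m < n \<longrightarrow> 0 \<le> walk X \<theta> m \<and> walk X \<theta> m < 1)}"

definition upward_looking :: "real measure \<Rightarrow> real \<Rightarrow> real \<Rightarrow> bool" where
  "upward_looking Q \<mu> p0 \<longleftrightarrow>
     (\<forall>\<theta><\<mu>. exit_up_prob Q \<theta> \<ge> p0 \<or>
              (\<integral>x. (x - \<theta>) * indicator {\<theta>..} x \<partial>Q) \<ge> p0)"

definition unif_upward_looking :: "(real \<Rightarrow> real measure) \<Rightarrow> real \<Rightarrow> real \<Rightarrow> bool" where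
  "unif_upward_looking P p0 \<delta>0 \<longleftrightarrow>
     0 < p0 \<and> 0 < \<delta>0 \<and> (\<forall>\<mu>\<in>{0..1}. \<mu> \<ge> 1 - \<delta>0 \<longrightarrow> upward_looking (P \<mu>) \<mu> p0)"

definition prior_dist :: "real measure \<Rightarrow> bool" where
  "prior_dist \<Gamma> \<longleftrightarrow> prob_space \<Gamma> \<and> measure \<Gamma> {0..1} = 1 \<and>
     (\<exists>g. g \<in> borel_measurable borel \<and> \<Gamma> = density lborel g)"

definition one_regular :: "real measure \<Rightarrow> bool" where
  "one_regular \<Gamma> \<longleftrightarrow> (\<exists>c0 C0. 0 < c0 \<and> c0 < C0 \<and>
     (\<forall>\<epsilon>. 0 < \<epsilon> \<and> \<epsilon> \<le> 1 \<longrightarrow>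
        c0 * \<epsilon> \<le> measure \<Gamma> {1 - \<epsilon><..} \<and>
        measure \<Gamma> {1 - \<epsilon><..} \<le> measure \<Gamma> {1 - \<epsilon>..} \<and>
        measure \<Gamma> {1 - \<epsilon>..} \<le> C0 * \<epsilon>))"

text \<open>Arms are 0..k-1, times 0..T-1 (time t here is time t+1 of the paper).
  Y (i,t) is the reward arm i would give if pulled at time t.
  A history is the list of arms pulled so far (entry t = arm pulled at time t).\<close>
definition emp_mean :: "(nat \<times> nat \<Rightarrow> real) \<Rightarrow> nat list \<Rightarrow> nat \<Rightarrow> real" where
  "emp_mean Y as i =
     (\<Sum>t\<in>{t. t < length as \<and> as ! t = i}. Y (i, t)) / real (card {t. t < length as \<and> as ! t = i})"

text \<open>State after time n: (current index i, arms pulled at times 0..n). Ties in the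
  final argmax are broken towards the smallest index.\<close>
fun sg_run :: "nat \<Rightarrow> real \<Rightarrow> (nat \<times> nat \<Rightarrow> real) \<Rightarrow> nat \<Rightarrow> nat \<times> nat list" where
  "sg_run k \<upsilon> Y 0 = (0, [0])"
| "sg_run k \<upsilon> Y (Suc n) = (case sg_run k \<upsilon> Y n of (i, as) \<Rightarrow>
     if emp_mean Y as i \<ge> 1 - \<upsilon> then (i, as @ [i])
     else if Suc i < k then (Suc i, as @ [Suc i])
     else (i, as @ [LEAST j. j < k \<and> (\<forall>j'<k. emp_mean Y as j' \<le> emp_mean Y as j)]))"

definition seq_greedy :: "nat \<Rightarrow> real \<Rightarrow> (nat \<times> nat \<Rightarrow> real) \<Rightarrow> nat \<Rightarrow> nat" where
  "seq_greedy k \<upsilon> Y t = snd (sg_run k \<upsilon> Y t) ! t"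

definition cond_regret ::
  "(real \<Rightarrow> real measure) \<Rightarrow> nat \<Rightarrow> nat \<Rightarrow> ((nat \<times> nat \<Rightarrow> real) \<Rightarrow> nat \<Rightarrow> nat) \<Rightarrow> (nat \<Rightarrow> real) \<Rightarrow> real" where
  "cond_regret P T k pol \<mu> =
     real T * Max (\<mu> ` {..<k}) -
     (\<Sum>t<T. \<integral>Y. \<mu> (pol Y t) \<partial>(PiM ({..<k} \<times> {..<T}) (\<lambda>(i, s). P (\<mu> i))))"

definition bayes_regret ::
  "(real \<Rightarrow> real measure) \<Rightarrow> real measure \<Rightarrow> nat \<Rightarrow> nat \<Rightarrow> ((nat \<times> nat \<Rightarrow> real) \<Rightarrow> nat \<Rightarrow> nat) \<Rightarrow> real" where
  "bayes_regret P \<Gamma> T k pol = (\<integral>\<mu>. cond_regret P T k pol \<mu> \<partial>(PiM {..<k} (\<lambda>_. \<Gamma>)))"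

definition Lg :: "nat \<Rightarrow> nat \<Rightarrow> real" where
  "Lg T k = 1 + ln (real T + real k)"

text \<open>For every choice delta(T,k) = Theta~(f(T,k)) (i.e. within a factor c * Lg^a of f, both
  directions), Seq-Greedy with upsilon = 2 delta has Bayesian regret O~(g(T,k)),
  uniformly over all T, k >= 1.\<close>
definition seq_greedy_bound ::
  "(real \<Rightarrow> real measure) \<Rightarrow> real measure \<Rightarrow> (nat \<Rightarrow> nat \<Rightarrow> real) \<Rightarrow> (nat \<Rightarrow> nat \<Rightarrow> real) \<Rightarrow> bool" where
  "seq_greedy_bound P \<Gamma> f g \<longleftrightarrow>
     (\<forall>(c::real) (a::nat) (\<delta>::nat \<Rightarrow> nat \<Rightarrow> real). 0 < c \<longrightarrow>
        (\<forall>T k. 1 \<le> T \<longrightarrow> 1 \<le> k \<longrightarrow>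
           f T k / (c * Lg T k ^ a) \<le> \<delta> T k \<and> \<delta> T k \<le> c * Lg T k ^ a * f T k) \<longrightarrow>
        (\<exists>(C::real) (b::nat). \<forall>T k. 1 \<le> T \<longrightarrow> 1 \<le> k \<longrightarrow>
           bayes_regret P \<Gamma> T k (seq_greedy k (2 * \<delta> T k)) \<le> C * Lg T k ^ b * g T k))"

end

(* Both regret terms are controlled by supermartingales. For an arm of mean m, let q be the
   probability that its random walk of rewards minus a threshold never becomes negative. The walk
   stopped once it is negative, composed with the ruin probability, is a martingale whatever the
   policy does, and so is the product over several arms. Seq-Greedy pulls arm i only after all
   arms j < i have dropped below the threshold 1 - 2 delta, so multiplying that product over j < i by
   the exponential of the walk of arm i bounds the expected number of pulls of arm i by
   O(1 / (1 - m)^2) times the product of the 1 - q over j < i. Integrated over the prior this is a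
   geometric series in i. A second, lower threshold 1 - 2 delta' (delta' = delta times a power of
   the logarithm) guarantees that some arm survives with high probability, so that the argmax phase
   is harmless even when delta is small by logarithmic factors.

   The survival probability is bounded below by the drift: drift <= E[(first step)^+; survival].
   For Bernoulli rewards this gives q >= 1/2, for general 1-subgaussian rewards
   q >= c * delta / (1 + ln (1 / delta)). *)

theory Submission
  imports Defs
begin

section \<open>Survival of a random walk\<close>

text \<open>Adaptive pulling makes the samples of different arms dependent, so independence is never
  applied to the observed walks. It enters through a potential with one factor per arm, of which a
  round changes only the factor of the pulled arm. Dropping events are bounded by ruin probabilities
  at the current states, and expected numbers of pulls by the potential lost per pull, summed over
  time. Regret is charged against 1 instead of the best mean, so a pull of an arm of mean m costs 1
  - m. If 1 - m \<le> 4 delta', this is part of 4 delta' T; otherwise the cost times 1 / (1 - m)^2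
  pulls leaves 1 / (1 - m), whose integral over the prior is only logarithmic. If survival has
  probability of order d^j up to a logarithm, an arm is good and survives with probability of order
  d^(j+1), and the averaged bound is, up to logarithms, T exp(- k delta'^(j+1)) + T delta' + 1 /
  delta^(j+1). Hence the balance k delta^(j+1) \<ge> 1 and T delta^(j+2) \<ge> 1, which for j = 0,
  2, 1 gives the exponents of (i), (ii), (iii).\<close>

definition survival_event :: "real measure \<Rightarrow> real \<Rightarrow> (nat \<Rightarrow> real) set" where
  "survival_event Q \<theta> = {\<omega> \<in> space (PiM UNIV (\<lambda>_::nat. Q)). \<forall>n. 0 \<le> walk \<omega> \<theta> n}"

definition survival_prob :: "real measure \<Rightarrow> real \<Rightarrow> real" where
  "survival_prob Q \<theta> = measure (PiM UNIV (\<lambda>_::nat. Q)) (survival_event Q \<theta>)"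

text \<open>The starting point is an argument because the current state of an arm will be inserted:
  this is the harmonic function of the killed walk. Time 0 counts, so the value is 1 at every
  negative point. Values in \<open>ennreal\<close> spare all integrability conditions.\<close>

definition ruin :: "real measure \<Rightarrow> real \<Rightarrow> real \<Rightarrow> ennreal" where
  "ruin Q \<theta> x = (\<integral>\<^sup>+\<omega>. indicator {\<omega>. \<exists>n. x + walk \<omega> \<theta> n < 0} \<omega> \<partial>PiM UNIV (\<lambda>_::nat. Q))"

text \<open>Freezing at the first negative value makes the state remember that the arm was once
  below the threshold, even if later pulls raise its empirical mean again.\<close>

definition killed_step :: "real \<Rightarrow> real \<Rightarrow> real \<Rightarrow> real" where
  "killed_step \<theta> x y = (if x < 0 then x else x + y - \<theta>)"

text \<open>The minimum of the walk over times 0 to \<open>N\<close>. Recursion at the first step,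
  not the last, leaves a shifted sequence, which is again i.i.d. and independent of that
  step.\<close>

primrec walk_min :: "real \<Rightarrow> nat \<Rightarrow> (nat \<Rightarrow> real) \<Rightarrow> real" where
  "walk_min \<theta> 0 \<omega> = 0"
| "walk_min \<theta> (Suc N) \<omega> = min 0 (\<omega> 0 - \<theta> + walk_min \<theta> N (\<lambda>n. \<omega> (Suc n)))"

lemma walk_0 [simp]: "walk X \<theta> 0 = 0"
  by (simp add: walk_def)

lemma walk_Suc_shift: "walk X \<theta> (Suc n) = X 0 - \<theta> + walk (\<lambda>n. X (Suc n)) \<theta> n"
  unfolding walk_def by (subst sum.lessThan_Suc_shift) (simp add: algebra_simps)

text \<open>The offset \<open>x\<close> is general so that the induction can absorb the first step
  into it.\<close>

lemma add_walk_min_nonneg_iff: "0 \<le> x + walk_min \<theta> N \<omega> \<longleftrightarrow> (\<forall>n\<le>N. 0 \<le> x + walk \<omega> \<theta> n)"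
proof (induction N arbitrary: x \<omega>)
  case (Suc N)
  have "0 \<le> x + walk_min \<theta> (Suc N) \<omega> \<longleftrightarrow>
      0 \<le> x \<and> 0 \<le> (x + (\<omega> 0 - \<theta>)) + walk_min \<theta> N (\<lambda>n. \<omega> (Suc n))"
    by (auto simp: min_def)
  also have "\<dots> \<longleftrightarrow> 0 \<le> x + walk \<omega> \<theta> 0 \<and> (\<forall>n\<le>N. 0 \<le> x + walk \<omega> \<theta> (Suc n))"
    unfolding Suc.IH by (simp add: walk_Suc_shift add.assoc)
  also have "\<dots> \<longleftrightarrow> (\<forall>n\<le>Suc N. 0 \<le> x + walk \<omega> \<theta> n)"
    by (metis Suc_le_mono le0 not0_implies_Suc)
  finally show ?case .
qed simp

lemma walk_min_decreasing: "walk_min \<theta> (Suc N) \<omega> \<le> walk_min \<theta> N \<omega>"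
  by (induction N arbitrary: \<omega>) (auto simp: min_le_iff_disj)

lemma walk_min_abs_le: "\<bar>walk_min \<theta> N \<omega>\<bar> \<le> (\<Sum>i<N. \<bar>\<omega> i - \<theta>\<bar>)"
proof (induction N arbitrary: \<omega>)
  case (Suc N)
  show ?case using Suc.IH[of "\<lambda>n. \<omega> (Suc n)"]
    unfolding sum.lessThan_Suc_shift by auto
qed simp

locale real_walk = sequence_space Q for Q :: "real measure" +
  assumes sets_Q [measurable_cong, simp]: "sets Q = sets borel"
begin

lemma space_Q [simp]: "space Q = UNIV"
  using sets_eq_imp_space_eq[OF sets_Q] by simp

lemma space_S [simp]: "space S = UNIV"
  by (simp add: space_PiM)

lemma measurable_component_S [measurable]: "(\<lambda>\<omega>. \<omega> n) \<in> borel_measurable S"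
  using measurable_component_singleton[of n UNIV "\<lambda>_. Q"] by (simp cong: measurable_cong_sets)

lemma measurable_walk [measurable]: "(\<lambda>\<omega>. walk \<omega> \<theta> n) \<in> borel_measurable S"
  unfolding walk_def by measurable

lemma measurable_shift: "(\<lambda>\<omega> n. \<omega> (Suc n)) \<in> S \<rightarrow>\<^sub>M S"
  by (rule measurable_PiM_single') (auto cong: measurable_cong_sets)

lemma distr_shift: "distr S S (\<lambda>\<omega> n. \<omega> (Suc n)) = S"
  using distr_PiM_reindex[of UNIV "\<lambda>_. Q" Suc UNIV] M.prob_space_axioms
  by (simp add: restrict_UNIV)

lemma distr_component: "distr S Q (\<lambda>\<omega>. \<omega> n) = Q"
  by (rule PiM_component) simp

lemma measurable_walk_min [measurable]: "(\<lambda>\<omega>. walk_min \<theta> N \<omega>) \<in> borel_measurable S"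
proof (induction N)
  case (Suc N)
  have [measurable]: "(\<lambda>\<omega>. walk_min \<theta> N (\<lambda>n. \<omega> (Suc n))) \<in> borel_measurable S"
    using measurable_compose[OF measurable_shift Suc] .
  show ?case by simp
qed simp

lemma ruin_neg: "x < 0 \<Longrightarrow> ruin Q \<theta> x = 1"
proof -
  assume "x < 0"
  then have "{\<omega>. \<exists>n. x + walk \<omega> \<theta> n < 0} = UNIV" by (auto intro: exI[of _ 0])
  then show ?thesis unfolding ruin_def using P.emeasure_space_1 by simp
qed

lemma ruin_0: "ruin Q \<theta> 0 = ennreal (1 - survival_prob Q \<theta>)"
proof -
  have ev: "survival_event Q \<theta> \<in> P.events"
    unfolding survival_event_def by measurable
  have "ruin Q \<theta> 0 = emeasure S (space S - survival_event Q \<theta>)"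
  proof -
    have "{\<omega>. \<exists>n. 0 + walk \<omega> \<theta> n < 0} = space S - survival_event Q \<theta>"
      by (auto simp: survival_event_def not_less[symmetric] simp del: not_less)
    then show ?thesis unfolding ruin_def using ev
      by (simp del: space_S add: nn_integral_indicator sets.compl_sets)
  qed
  also have "\<dots> = ennreal (1 - survival_prob Q \<theta>)"
    unfolding survival_prob_def using P.prob_compl[OF ev] by (simp add: P.emeasure_eq_measure)
  finally show ?thesis .
qed

lemma measurable_ruin [measurable]: "ruin Q \<theta> \<in> borel_measurable borel"
proof -
  have [measurable]: "(\<lambda>p. walk (snd p) \<theta> n) \<in> borel_measurable (borel \<Otimes>\<^sub>M S)" for n
    using measurable_compose[OF measurable_snd measurable_walk] .
  have "(\<lambda>x. \<integral>\<^sup>+\<omega>. indicator {p \<in> space (borel \<Otimes>\<^sub>M S). \<exists>n. fst p + walk (snd p) \<theta> n < 0} (x, \<omega>) \<partial>S)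
      \<in> borel_measurable borel"
    by (rule P.borel_measurable_nn_integral) measurable
  then show ?thesis unfolding ruin_def
    by (simp add: indicator_def space_pair_measure)
qed

text \<open>From a nonnegative start, ruin cannot happen at time 0. Splitting the sequence into its
  first entry and an independent copy of itself therefore turns ruin from \<open>x\<close> into ruin
  from the point reached after one step.\<close>

lemma nn_integral_ruin_step:
  assumes "0 \<le> x"
  shows "(\<integral>\<^sup>+y. ruin Q \<theta> (x + y - \<theta>) \<partial>Q) = ruin Q \<theta> x"
proof -
  let ?I = "\<lambda>x \<omega>. indicator {\<omega>. \<exists>n. x + walk \<omega> \<theta> n < 0} \<omega> :: ennreal"
  have [measurable]: "?I x \<in> borel_measurable S" for x
  proof -
    have "?I x = indicator {\<omega> \<in> space S. \<exists>n. x + walk \<omega> \<theta> n < 0}" by (auto simp: indicator_def)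
    then show ?thesis by simp
  qed
  have m: "(\<lambda>(s, \<omega>). case_nat s \<omega>) \<in> Q \<Otimes>\<^sub>M S \<rightarrow>\<^sub>M S" by measurable
  have "ruin Q \<theta> x = (\<integral>\<^sup>+\<omega>. ?I x \<omega> \<partial>distr (Q \<Otimes>\<^sub>M S) S (\<lambda>(s, \<omega>). case_nat s \<omega>))"
    unfolding ruin_def PiM_iter ..
  also have "\<dots> = (\<integral>\<^sup>+p. ?I x (case_nat (fst p) (snd p)) \<partial>(Q \<Otimes>\<^sub>M S))"
    by (subst nn_integral_distr[OF m]) (auto simp: case_prod_beta)
  also have "\<dots> = (\<integral>\<^sup>+y. \<integral>\<^sup>+\<omega>. ?I x (case_nat y \<omega>) \<partial>S \<partial>Q)"
  proof (subst P.nn_integral_fst[symmetric])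
    have "(\<lambda>p. ?I x ((\<lambda>(s, \<omega>). case_nat s \<omega>) p)) \<in> borel_measurable (Q \<Otimes>\<^sub>M S)"
      by (rule measurable_compose[OF m]) measurable
    then show "(\<lambda>p. ?I x (case_nat (fst p) (snd p))) \<in> borel_measurable (Q \<Otimes>\<^sub>M S)"
      by (simp add: case_prod_beta)
  qed simp
  also have "\<dots> = (\<integral>\<^sup>+y. \<integral>\<^sup>+\<omega>. ?I (x + y - \<theta>) \<omega> \<partial>S \<partial>Q)"
  proof -
    have "(\<exists>n. x + walk (case_nat y \<omega>) \<theta> n < 0) \<longleftrightarrow> (\<exists>n. x + y - \<theta> + walk \<omega> \<theta> n < 0)" for y \<omega>
    proof -
      have "(\<exists>n. x + walk (case_nat y \<omega>) \<theta> n < 0) \<longleftrightarrow> (\<exists>n. x + walk (case_nat y \<omega>) \<theta> (Suc n) < 0)"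
        using assms by (metis add.right_neutral not_less walk_0 not0_implies_Suc)
      then show ?thesis by (simp add: walk_Suc_shift algebra_simps)
    qed
    then show ?thesis by (simp add: indicator_def)
  qed
  finally show ?thesis unfolding ruin_def by simp
qed

text \<open>Killing extends the harmonic equation to negative \<open>x\<close>, where the state
  stays put. The potential argument then needs no stopping times.\<close>

lemma nn_integral_ruin_killed_step: "(\<integral>\<^sup>+y. ruin Q \<theta> (killed_step \<theta> x y) \<partial>Q) = ruin Q \<theta> x"
  using nn_integral_ruin_step[of x \<theta>] M.emeasure_space_1
  by (cases "x < 0") (auto simp: killed_step_def)

text \<open>Splitting off the first step turns the minimum of the walk over \<open>N + 1\<close> steps into
  \<open>min 0\<close> of the first step plus an independent copy of the minimum over \<open>N\<close> steps. Taking
  expectations, the mean of the positive part of that sum is at least the drift. On the other hand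
  the positive part is at most the first step and vanishes unless the walk survives.\<close>

lemma drift_le_survival:
  assumes int: "integrable Q (\<lambda>x. x)" and B: "0 \<le> B"
  shows "(\<integral>x. x \<partial>Q) - \<theta> \<le> B * survival_prob Q \<theta> + (\<integral>x. max 0 (x - \<theta> - B) \<partial>Q)"
proof -
  have intQ: "integrable Q (\<lambda>x. x - \<theta>)" using int by simp
  have intc: "integrable S (\<lambda>\<omega>. \<omega> n - \<theta>)" for n
    using intQ integrable_distr_eq[of "\<lambda>\<omega>. \<omega> n" S Q "\<lambda>x. x - \<theta>"]
    by (simp add: distr_component)
  have intm: "integrable S (walk_min \<theta> N)" for N
    by (rule Bochner_Integration.integrable_bound[of _ "\<lambda>\<omega>. \<Sum>i<N. \<bar>\<omega> i - \<theta>\<bar>"])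
      (use intc walk_min_abs_le[of \<theta> N] in \<open>auto intro!: integrable_abs\<close>)
  have intms: "integrable S (\<lambda>\<omega>. walk_min \<theta> N (\<lambda>n. \<omega> (Suc n)))"
    and Ems: "(\<integral>\<omega>. walk_min \<theta> N (\<lambda>n. \<omega> (Suc n)) \<partial>S) = (\<integral>\<omega>. walk_min \<theta> N \<omega> \<partial>S)" for N
    using integrable_distr_eq[OF measurable_shift measurable_walk_min, of \<theta> N]
      integral_distr[OF measurable_shift measurable_walk_min, of \<theta> N] intm[of N]
    by (simp_all add: distr_shift)
  have E0: "(\<integral>\<omega>. \<omega> 0 - \<theta> \<partial>S) = (\<integral>x. x \<partial>Q) - \<theta>"
  proof -
    have "(\<integral>\<omega>. \<omega> 0 - \<theta> \<partial>S) = (\<integral>x. x - \<theta> \<partial>distr S Q (\<lambda>\<omega>. \<omega> 0))"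
      by (subst integral_distr) (auto simp: measurable_cong_sets[OF sets_Q refl])
    also have "\<dots> = (\<integral>x. x \<partial>Q) - \<theta>"
      unfolding distr_component using int M.prob_space by simp
    finally show ?thesis .
  qed
  have intp: "integrable S (\<lambda>\<omega>. max 0 (\<omega> 0 - \<theta> - B))"
    using intc[of 0] by (intro integrable_max) auto
  have Ep: "(\<integral>\<omega>. max 0 (\<omega> 0 - \<theta> - B) \<partial>S) = (\<integral>x. max 0 (x - \<theta> - B) \<partial>Q)"
  proof -
    have "(\<integral>\<omega>. max 0 (\<omega> 0 - \<theta> - B) \<partial>S) = (\<integral>x. max 0 (x - \<theta> - B) \<partial>distr S Q (\<lambda>\<omega>. \<omega> 0))"
      by (subst integral_distr) (auto simp: measurable_cong_sets[OF sets_Q refl])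
    then show ?thesis unfolding distr_component .
  qed
  define D where "D N = {\<omega> \<in> space S. \<forall>n\<le>N. 0 \<le> walk \<omega> \<theta> n}" for N
  have D_meas [measurable]: "D N \<in> sets S" for N
    unfolding D_def by measurable
  have bound: "(\<integral>x. x \<partial>Q) - \<theta> \<le> B * measure S (D (Suc N)) + (\<integral>x. max 0 (x - \<theta> - B) \<partial>Q)" for N
  proof -
    define V where "V \<omega> = \<omega> 0 - \<theta> + walk_min \<theta> N (\<lambda>n. \<omega> (Suc n))" for \<omega>
    have intV: "integrable S V" unfolding V_def using intc intms by simp
    have EV: "(\<integral>\<omega>. V \<omega> \<partial>S) = (\<integral>x. x \<partial>Q) - \<theta> + (\<integral>\<omega>. walk_min \<theta> N \<omega> \<partial>S)"
      unfolding V_def E0[symmetric] Ems[symmetric]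
      by (rule Bochner_Integration.integral_add[OF intc intms])
    have "(\<integral>x. x \<partial>Q) - \<theta> \<le> (\<integral>x. x \<partial>Q) - \<theta> + (\<integral>\<omega>. walk_min \<theta> N \<omega> \<partial>S) - (\<integral>\<omega>. walk_min \<theta> (Suc N) \<omega> \<partial>S)"
      using integral_mono[OF intm intm walk_min_decreasing, of N] by simp
    also have "\<dots> = (\<integral>\<omega>. V \<omega> - walk_min \<theta> (Suc N) \<omega> \<partial>S)"
      by (subst Bochner_Integration.integral_diff[OF intV intm]) (simp add: EV)
    \<comment> \<open>The integrand on the left is the positive part of \<open>V\<close>. It
      vanishes unless the walk survives the first step and \<open>N\<close> more, hence
      \<open>D (Suc N)\<close>. On survival it is at most the first step, which is at most
      \<open>B\<close> plus its excess over \<open>B\<close>.\<close>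
    also have "\<dots> \<le> (\<integral>\<omega>. B * indicator (D (Suc N)) \<omega> + max 0 (\<omega> 0 - \<theta> - B) \<partial>S)"
    proof (rule integral_mono)
      fix \<omega> assume "\<omega> \<in> space S"
      have "V \<omega> \<le> \<omega> 0 - \<theta>"
        using walk_min_decreasing[of \<theta>] 
        by (simp add: V_def) (induction N, auto)
      moreover have "V \<omega> < 0 \<or> \<omega> \<in> D (Suc N)"
      proof (rule disjCI)
        assume "\<omega> \<notin> D (Suc N)"
        then obtain n where n: "n \<le> Suc N" "walk \<omega> \<theta> n < 0"
          using \<open>\<omega> \<in> space S\<close> by (auto simp: D_def not_le)
        then obtain m where "n = Suc m" by (cases n) auto
        then have "\<not> (\<forall>n\<le>N. 0 \<le> (\<omega> 0 - \<theta>) + walk (\<lambda>n. \<omega> (Suc n)) \<theta> n)"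
          using n by (auto simp: walk_Suc_shift not_le)
        then show "V \<omega> < 0" unfolding add_walk_min_nonneg_iff[symmetric] V_def by simp
      qed
      ultimately show "V \<omega> - walk_min \<theta> (Suc N) \<omega> \<le> B * indicator (D (Suc N)) \<omega> + max 0 (\<omega> 0 - \<theta> - B)"
        using B by (auto simp: V_def[symmetric] indicator_def)
    qed (use intV intm[of "Suc N"] intp in \<open>auto intro!: integrable_diff integrable_add integrable_mult_right simp: less_top[symmetric] simp del: walk_min.simps\<close>)
    also have "\<dots> = B * measure S (D (Suc N)) + (\<integral>x. max 0 (x - \<theta> - B) \<partial>Q)"
      using intp Ep by (subst Bochner_Integration.integral_add)
        (auto intro!: integrable_mult_right simp: less_top[symmetric])
    finally show ?thesis .
  qed
  \<comment> \<open>Continuity from above: the bound for finite horizons passes to survival at all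
    times.\<close>
  have dec: "decseq D" unfolding D_def decseq_def by auto
  have "(\<Inter>N. D N) = survival_event Q \<theta>"
    unfolding D_def survival_event_def by auto
  then have "(\<lambda>N. measure S (D N)) \<longlonglongrightarrow> survival_prob Q \<theta>"
    using P.finite_Lim_measure_decseq[of D] dec D_meas by (simp add: survival_prob_def image_subset_iff)
  then have "(\<lambda>N. B * measure S (D (Suc N)) + (\<integral>x. max 0 (x - \<theta> - B) \<partial>Q))
      \<longlonglongrightarrow> B * survival_prob Q \<theta> + (\<integral>x. max 0 (x - \<theta> - B) \<partial>Q)"
    by (intro tendsto_intros LIMSEQ_Suc)
  then show ?thesis
    by (rule Lim_bounded2) (use bound in auto)
qed

end

lemma real_walkI: "prob_space Q \<Longrightarrow> sets Q = sets borel \<Longrightarrow> real_walk Q"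
  by (auto simp: real_walk_def real_walk_axioms_def sequence_space_def product_prob_space_def
    product_prob_space_axioms_def product_sigma_finite_def intro: prob_space_imp_sigma_finite)

section \<open>Supermartingales for adaptively sampled arms\<close>

text \<open>One recursion serves two purposes: with \<open>free_step\<close> it is the empirical
  walk of the arm, with \<open>killed_step\<close> the absorbed one. The state at \<open>t\<close>
  reflects the rounds before \<open>t\<close> only.\<close>

primrec arm_state ::
  "(real \<Rightarrow> real \<Rightarrow> real) \<Rightarrow> ((nat \<times> nat \<Rightarrow> real) \<Rightarrow> nat \<Rightarrow> nat) \<Rightarrow> nat \<Rightarrow> (nat \<times> nat \<Rightarrow> real) \<Rightarrow> nat \<Rightarrow> real"
where
  "arm_state f pol i Y 0 = 0"
| "arm_state f pol i Y (Suc t) =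
     (if pol Y t = i then f (arm_state f pol i Y t) (Y (i, t)) else arm_state f pol i Y t)"

text \<open>Outside the index set every point of the product space takes the constant value
  \<open>undefined\<close>, so the claim holds for all \<open>j\<close> and measurability of a
  policy needs no range conditions.\<close>

lemma measurable_reward_table:
  assumes sets_Q: "\<And>i. sets (Q i) = sets borel"
  shows "(\<lambda>Y. Y j) \<in> borel_measurable (PiM ({..<k} \<times> {..<T}) (\<lambda>(i, s). Q i))" (is "_ \<in> borel_measurable ?R")
proof (cases "j \<in> {..<k} \<times> {..<T}")
  case True
  have "sets (case j of (i, s) \<Rightarrow> Q i) = sets borel" by (simp add: case_prod_beta sets_Q)
  then show ?thesis
    using measurable_component_singleton[OF True, of "\<lambda>(i, s). Q i"] measurable_cong_sets by blast
next
  case False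
  then have "Y j = undefined" if "Y \<in> space ?R" for Y
    using that by (cases j) (auto simp: space_PiM PiE_def extensional_def)
  then show ?thesis by (subst measurable_cong[where g = "\<lambda>_. undefined"]) auto
qed

text \<open>\<open>pol_upd\<close> is non-anticipation: the choice in round \<open>t\<close> does
  not change with rewards of round \<open>t\<close> or later.\<close>

locale adaptive_sampling =
  fixes k T :: nat and Q :: "nat \<Rightarrow> real measure"
    and pol :: "(nat \<times> nat \<Rightarrow> real) \<Rightarrow> nat \<Rightarrow> nat"
  assumes prob_Q: "\<And>i. prob_space (Q i)"
    and sets_Q [measurable_cong, simp]: "\<And>i. sets (Q i) = sets borel"
    and pol_less: "\<And>Y t. pol Y t < k"
    and pol_upd: "\<And>Y i s t y. t \<le> s \<Longrightarrow> pol (Y((i, s) := y)) t = pol Y t"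
    and pol_measurable [measurable]:
      "\<And>t. (\<lambda>Y. pol Y t) \<in> PiM ({..<k} \<times> {..<T}) (\<lambda>(i, s). Q i) \<rightarrow>\<^sub>M count_space UNIV"
begin

abbreviation rewards :: "(nat \<times> nat \<Rightarrow> real) measure" where
  "rewards \<equiv> PiM ({..<k} \<times> {..<T}) (\<lambda>(i, s). Q i)"

lemma space_Q [simp]: "space (Q i) = UNIV"
  using sets_eq_imp_space_eq[OF sets_Q] by simp

text \<open>A coordinate of a product measure may be replaced by a fresh independent draw. This is
  the substitute for conditioning on the past: whatever ignores coordinate \<open>(i, t)\<close>
  comes out of the inner integral.\<close>

lemma nn_integral_resample:
  assumes F [measurable]: "F \<in> borel_measurable rewards" and j: "i < k" "t < T"
  shows "(\<integral>\<^sup>+Y. F Y \<partial>rewards) = (\<integral>\<^sup>+Y. \<integral>\<^sup>+y. F (Y((i, t) := y)) \<partial>Q i \<partial>rewards)"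
proof -
  let ?j = "(i, t)" and ?I = "{..<k} \<times> {..<T} - {(i, t)}" and ?M = "\<lambda>(i, s::nat). Q i"
  interpret product_sigma_finite ?M
    using prob_Q by (intro product_sigma_finite.intro) (auto intro: prob_space_imp_sigma_finite)
  interpret Qi: prob_space "Q i" by (rule prob_Q)
  have J: "{..<k} \<times> {..<T} = insert ?j ?I" using j by auto
  have F2: "F \<in> borel_measurable (PiM (insert ?j ?I) ?M)"
    using F by (simp only: J[symmetric])
  have meas: "(\<lambda>p. F ((fst p)(?j := snd p))) \<in> borel_measurable (PiM (insert ?j ?I) ?M \<Otimes>\<^sub>M Q i)"
  proof -
    have 1: "(\<lambda>p. (fst p)(?j := snd p)) \<in> PiM (insert ?j ?I) ?M \<Otimes>\<^sub>M Q i \<rightarrow>\<^sub>M PiM (insert ?j ?I) ?M"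
    proof (rule measurable_PiM_single')
      fix l assume l: "l \<in> insert ?j ?I"
      show "(\<lambda>p. ((fst p)(?j := snd p)) l) \<in> PiM (insert ?j ?I) ?M \<Otimes>\<^sub>M Q i \<rightarrow>\<^sub>M ?M l"
      proof (cases "l = ?j")
        case False
        then show ?thesis using measurable_compose[OF measurable_fst measurable_component_singleton[OF l, of ?M]]
          by simp
      qed (simp add: measurable_snd)
    next
      show "(\<lambda>p. (fst p)(?j := snd p)) \<in> space (PiM (insert ?j ?I) ?M \<Otimes>\<^sub>M Q i) \<rightarrow> (\<Pi>\<^sub>E i\<in>insert ?j ?I. space (?M i))"
        by (auto simp: space_pair_measure space_PiM PiE_def extensional_def)
    qed
    from measurable_compose[OF 1 F2] show ?thesis .
  qed
  define F' where "F' Y = (\<integral>\<^sup>+y. F (Y(?j := y)) \<partial>Q i)" for Y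
  have F': "F' \<in> borel_measurable (PiM (insert ?j ?I) ?M)"
    unfolding F'_def using Qi.borel_measurable_nn_integral[of "\<lambda>Y y. F (Y(?j := y))"] meas
    by (simp add: case_prod_beta)
  have "(\<integral>\<^sup>+Y. F' Y \<partial>PiM (insert ?j ?I) ?M) = (\<integral>\<^sup>+x. \<integral>\<^sup>+y. F' (x(?j := y)) \<partial>Q i \<partial>PiM ?I ?M)"
    by (subst product_nn_integral_insert[OF _ _ F']) auto
  \<comment> \<open>\<open>F'\<close> does not see the coordinate \<open>?j\<close>, because a
    second update overwrites the first, and \<open>Q i\<close> has mass one.\<close>
  also have "\<dots> = (\<integral>\<^sup>+x. F' x \<partial>PiM ?I ?M)"
    by (simp add: F'_def Qi.emeasure_space_1[simplified])
  also have "\<dots> = (\<integral>\<^sup>+Y. F Y \<partial>PiM (insert ?j ?I) ?M)"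
    by (subst product_nn_integral_insert[OF _ _ F2]) (auto simp: F'_def[abs_def])
  finally show ?thesis unfolding F'_def J[symmetric] ..
qed

lemma measurable_reward [measurable]: "(\<lambda>Y. Y j) \<in> borel_measurable rewards"
  by (rule measurable_reward_table) simp

lemma measurable_arm_state:
  assumes [measurable]: "(\<lambda>p. f (fst p) (snd p)) \<in> borel_measurable (borel \<Otimes>\<^sub>M borel)"
  shows "(\<lambda>Y. arm_state f pol i Y t) \<in> borel_measurable rewards"
proof (induction t)
  case (Suc t)
  note Suc [measurable]
  have [measurable]: "(\<lambda>Y. f (arm_state f pol i Y t) (Y (i, t))) \<in> borel_measurable rewards"
    using measurable_compose[of "\<lambda>Y. (arm_state f pol i Y t, Y (i, t))" rewards "borel \<Otimes>\<^sub>M borel"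
      "\<lambda>p. f (fst p) (snd p)" borel] by simp
  show ?case by simp
qed simp

lemma arm_state_upd: "t \<le> s \<Longrightarrow> arm_state f pol i (Y((j, s) := y)) t = arm_state f pol i Y t"
  by (induction t) (auto simp: pol_upd)

text \<open>A round moves the factor of the pulled arm alone, so the product loses at least the
  fraction \<open>e i\<close> in expectation whenever arm \<open>i\<close> is pulled. Summing over
  the rounds telescopes, and all the losses together cannot exceed the initial product. With
  \<open>e = 0\<close> this is the plain supermartingale bound.\<close>

theorem potential_bound:
  fixes \<phi> :: "nat \<Rightarrow> real \<Rightarrow> ennreal" and e :: "nat \<Rightarrow> ennreal"
  assumes f: "\<And>i. (\<lambda>p. f i (fst p) (snd p)) \<in> borel_measurable (borel \<Otimes>\<^sub>M borel)"
    and \<phi> [measurable]: "\<And>i. \<phi> i \<in> borel_measurable borel"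
    and step: "\<And>i x. i < k \<Longrightarrow> (\<integral>\<^sup>+y. \<phi> i (f i x y) \<partial>Q i) + e i * \<phi> i x \<le> \<phi> i x"
    and t: "t \<le> T"
  shows "(\<integral>\<^sup>+Y. (\<Prod>i<k. \<phi> i (arm_state (f i) pol i Y t)) \<partial>rewards)
    + (\<Sum>s<t. \<integral>\<^sup>+Y. e (pol Y s) * (\<Prod>i<k. \<phi> i (arm_state (f i) pol i Y s)) \<partial>rewards)
    \<le> (\<Prod>i<k. \<phi> i 0)"
  using t
proof (induction t)
  case 0
  have "prob_space rewards"
    by (rule prob_space_PiM) (auto simp: prob_Q)
  then show ?case by (simp add: prob_space.emeasure_space_1)
next
  case (Suc t)
  let ?st = "\<lambda>i Y t. arm_state (f i) pol i Y t"
  define \<Phi> where "\<Phi> Y t = (\<Prod>i<k. \<phi> i (?st i Y t))" for Y t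
  note measurable_arm_state[OF f, measurable]
  have [measurable]: "(\<lambda>Y. f i (?st i Y t) (Y (i, t))) \<in> borel_measurable rewards" for i t
    using measurable_compose[of "\<lambda>Y. (?st i Y t, Y (i, t))" rewards "borel \<Otimes>\<^sub>M borel"
      "\<lambda>p. f i (fst p) (snd p)" borel] f by simp
  have fm: "f i x \<in> borel_measurable borel" for i x
    using measurable_compose[of "\<lambda>y. (x, y)" borel "borel \<Otimes>\<^sub>M borel", OF _ f] by simp
  \<comment> \<open>The event that \<open>a\<close> is pulled now, times the factors of the other
    arms. It does not depend on the reward \<open>(a, t)\<close> and so is a constant when that
    reward is resampled.\<close>
  define G where "G a Y = indicator {Y. pol Y t = a} Y * (\<Prod>i\<in>{..<k} - {a}. \<phi> i (?st i Y t))" for a Y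
  have G_meas [measurable]: "G a \<in> borel_measurable rewards" for a
  proof -
    have "(\<lambda>Y. (if pol Y t = a then 1 else 0) * (\<Prod>i\<in>{..<k} - {a}. \<phi> i (?st i Y t))) \<in> borel_measurable rewards"
      by measurable
    then show ?thesis by (simp add: G_def[abs_def] indicator_def)
  qed
  \<comment> \<open>Replaces the random index \<open>pol Y t\<close> by a finite sum over fixed
    arms, each of which can be resampled separately.\<close>
  have split: "H (pol Y t) = (\<Sum>a<k. indicator {Y. pol Y t = a} Y * H a)" for H :: "nat \<Rightarrow> ennreal" and Y
    using pol_less[of Y t] by (simp add: indicator_def sum.delta' if_distrib cong: if_cong)
  have prod_a: "(\<Prod>i<k. h i) = (\<Prod>i\<in>{..<k} - {a}. h i) * h a" if "a < k" for h :: "nat \<Rightarrow> ennreal" and a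
    using that by (subst prod.remove[of _ a]) (auto simp: mult.commute)
  have \<Phi>Suc: "\<Phi> Y (Suc t) = (\<Sum>a<k. G a Y * \<phi> a (f a (?st a Y t) (Y (a, t))))" for Y
  proof -
    have "\<Phi> Y (Suc t) = (\<Prod>i\<in>{..<k} - {pol Y t}. \<phi> i (?st i Y t)) * \<phi> (pol Y t) (f (pol Y t) (?st (pol Y t) Y t) (Y (pol Y t, t)))"
      unfolding \<Phi>_def by (subst prod_a[OF pol_less[of Y t]]) (auto intro!: prod.cong arg_cong2[of _ _ _ _ "(*)"])
    then show ?thesis unfolding G_def mult.assoc
      by (subst (asm) split) simp
  qed
  have \<Phi>t: "h (pol Y t) * \<Phi> Y t = (\<Sum>a<k. G a Y * (h a * \<phi> a (?st a Y t)))" for Y and h :: "nat \<Rightarrow> ennreal"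
  proof -
    have "h (pol Y t) * \<Phi> Y t = (\<Prod>i\<in>{..<k} - {pol Y t}. \<phi> i (?st i Y t)) * (h (pol Y t) * \<phi> (pol Y t) (?st (pol Y t) Y t))"
      unfolding \<Phi>_def by (subst prod_a[OF pol_less[of Y t]]) (simp add: mult_ac)
    then show ?thesis unfolding G_def mult.assoc
      by (subst (asm) split) simp
  qed
  have "(\<integral>\<^sup>+Y. \<Phi> Y (Suc t) \<partial>rewards) + (\<integral>\<^sup>+Y. e (pol Y t) * \<Phi> Y t \<partial>rewards) =
     (\<Sum>a<k. (\<integral>\<^sup>+Y. G a Y * \<phi> a (f a (?st a Y t) (Y (a, t))) \<partial>rewards) +
        (\<integral>\<^sup>+Y. G a Y * (e a * \<phi> a (?st a Y t)) \<partial>rewards))"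
    unfolding \<Phi>Suc \<Phi>t by (subst (1 2) nn_integral_sum) (auto simp: sum.distrib)
  also have "\<dots> \<le> (\<Sum>a<k. \<integral>\<^sup>+Y. G a Y * \<phi> a (?st a Y t) \<partial>rewards)"
  proof (rule sum_mono)
    fix a assume "a \<in> {..<k}"
    then have a: "a < k" by simp
    have G_upd: "G a (Y((a, t) := y)) = G a Y" for Y y
      by (simp add: G_def arm_state_upd pol_upd indicator_def)
    have "(\<integral>\<^sup>+Y. G a Y * \<phi> a (f a (?st a Y t) (Y (a, t))) \<partial>rewards)
        = (\<integral>\<^sup>+Y. \<integral>\<^sup>+y. G a Y * \<phi> a (f a (?st a Y t) y) \<partial>Q a \<partial>rewards)"
      using Suc.prems a by (subst nn_integral_resample[of _ a t]) (auto simp: G_upd arm_state_upd)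
    also have "\<dots> = (\<integral>\<^sup>+Y. G a Y * (\<integral>\<^sup>+y. \<phi> a (f a (?st a Y t) y) \<partial>Q a) \<partial>rewards)"
      using fm by (intro nn_integral_cong nn_integral_cmult) (auto simp: measurable_cong_sets[OF sets_Q refl])
    finally have "(\<integral>\<^sup>+Y. G a Y * \<phi> a (f a (?st a Y t) (Y (a, t))) \<partial>rewards) +
        (\<integral>\<^sup>+Y. G a Y * (e a * \<phi> a (?st a Y t)) \<partial>rewards) =
        (\<integral>\<^sup>+Y. G a Y * (\<integral>\<^sup>+y. \<phi> a (f a (?st a Y t) y) \<partial>Q a) \<partial>rewards) +
        (\<integral>\<^sup>+Y. G a Y * (e a * \<phi> a (?st a Y t)) \<partial>rewards)"
      by simp
    also have "\<dots> = (\<integral>\<^sup>+Y. G a Y * ((\<integral>\<^sup>+y. \<phi> a (f a (?st a Y t) y) \<partial>Q a) + e a * \<phi> a (?st a Y t)) \<partial>rewards)"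
    proof (subst nn_integral_add[symmetric])
      interpret Qa: prob_space "Q a" by (rule prob_Q)
      have "(\<lambda>p. \<phi> a (f a (fst p) (snd p))) \<in> borel_measurable (borel \<Otimes>\<^sub>M borel)"
        using measurable_compose[OF f \<phi>] .
      then have "(\<lambda>x. \<integral>\<^sup>+y. \<phi> a (f a x y) \<partial>Q a) \<in> borel_measurable borel"
        by (intro Qa.borel_measurable_nn_integral) (simp add: case_prod_beta cong: measurable_cong_sets)
      from measurable_compose[OF _ this, of "\<lambda>Y. ?st a Y t" rewards]
      show "(\<lambda>Y. G a Y * (\<integral>\<^sup>+y. \<phi> a (f a (?st a Y t) y) \<partial>Q a)) \<in> borel_measurable rewards"
        by measurable
    qed (auto simp: distrib_left)
    also have "\<dots> \<le> (\<integral>\<^sup>+Y. G a Y * \<phi> a (?st a Y t) \<partial>rewards)"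
      using step[OF a] by (intro nn_integral_mono mult_left_mono) auto
    finally show "(\<integral>\<^sup>+Y. G a Y * \<phi> a (f a (?st a Y t) (Y (a, t))) \<partial>rewards) +
        (\<integral>\<^sup>+Y. G a Y * (e a * \<phi> a (?st a Y t)) \<partial>rewards) \<le> (\<integral>\<^sup>+Y. G a Y * \<phi> a (?st a Y t) \<partial>rewards)" .
  qed
  also have "\<dots> = (\<integral>\<^sup>+Y. \<Phi> Y t \<partial>rewards)"
    using \<Phi>t[of "\<lambda>_. 1"] by (simp add: nn_integral_sum)
  finally have "(\<integral>\<^sup>+Y. \<Phi> Y (Suc t) \<partial>rewards) + (\<integral>\<^sup>+Y. e (pol Y t) * \<Phi> Y t \<partial>rewards) \<le> (\<integral>\<^sup>+Y. \<Phi> Y t \<partial>rewards)" .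
  from add_right_mono[OF this, of "\<Sum>s<t. \<integral>\<^sup>+Y. e (pol Y s) * \<Phi> Y s \<partial>rewards"]
  have "(\<integral>\<^sup>+Y. \<Phi> Y (Suc t) \<partial>rewards) + (\<Sum>s<Suc t. \<integral>\<^sup>+Y. e (pol Y s) * \<Phi> Y s \<partial>rewards)
      \<le> (\<integral>\<^sup>+Y. \<Phi> Y t \<partial>rewards) + (\<Sum>s<t. \<integral>\<^sup>+Y. e (pol Y s) * \<Phi> Y s \<partial>rewards)"
    by (simp only: sum.lessThan_Suc add_ac)
  also have "\<dots> \<le> (\<Prod>i<k. \<phi> i 0)"
    unfolding \<Phi>_def by (rule Suc.IH) (use Suc.prems in simp)
  finally show ?case unfolding \<Phi>_def .
qed

end

section \<open>Seq-Greedy for fixed means\<close>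

abbreviation (input) free_step :: "real \<Rightarrow> real \<Rightarrow> real \<Rightarrow> real" where
  "free_step \<theta> \<equiv> \<lambda>x y. x + y - \<theta>"

lemma arm_state_free_step:
  "arm_state (free_step \<theta>) pol i Y t = (\<Sum>s\<in>{s. s < t \<and> pol Y s = i}. Y (i, s) - \<theta>)"
proof (induction t)
  case (Suc t)
  show ?case
  proof (cases "pol Y t = i")
    case True
    then have "{s. s < Suc t \<and> pol Y s = i} = insert t {s. s < t \<and> pol Y s = i}"
      by (auto simp: less_Suc_eq)
    then show ?thesis using True Suc by simp
  next
    case False
    then have "{s. s < Suc t \<and> pol Y s = i} = {s. s < t \<and> pol Y s = i}"
      by (auto simp: less_Suc_eq)
    then show ?thesis using False Suc by simp
  qed
qed simp

lemma arm_state_killed_nonneg: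
  "0 \<le> arm_state (killed_step \<theta>) pol i Y t \<Longrightarrow>
    arm_state (killed_step \<theta>) pol i Y t = arm_state (free_step \<theta>) pol i Y t"
  by (induction t) (auto simp: killed_step_def split: if_splits)

lemma arm_state_killed_Suc_neg:
  "arm_state (killed_step \<theta>) pol i Y t < 0 \<Longrightarrow> arm_state (killed_step \<theta>) pol i Y (Suc t) < 0"
  by (simp add: killed_step_def)

lemma arm_state_killed_neg:
  "arm_state (free_step \<theta>) pol i Y t < 0 \<Longrightarrow> arm_state (killed_step \<theta>) pol i Y t < 0"
  using arm_state_killed_nonneg[of \<theta> pol i Y t] by linarith

section \<open>Seq-Greedy runs read through the walks of the arms\<close>

lemma length_sg_run [simp]: "length (snd (sg_run k \<upsilon> Y n)) = Suc n"
  by (induction n) (auto split: prod.split)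

lemma sg_run_nth: "s \<le> n \<Longrightarrow> snd (sg_run k \<upsilon> Y n) ! s = seq_greedy k \<upsilon> Y s"
proof (induction n)
  case (Suc n)
  show ?case
  proof (cases "s = Suc n")
    case False
    with Suc have IH: "s \<le> n" "snd (sg_run k \<upsilon> Y n) ! s = seq_greedy k \<upsilon> Y s" by auto
    have "snd (sg_run k \<upsilon> Y (Suc n)) ! s = snd (sg_run k \<upsilon> Y n) ! s"
      using IH(1) length_sg_run[of k \<upsilon> Y n]
      by (auto simp: nth_append split: prod.split simp del: length_sg_run)
    then show ?thesis using IH by simp
  qed (simp add: seq_greedy_def)
qed (simp add: seq_greedy_def)

text \<open>Multiply by the number of pulls. One earlier pull is required, since the empirical mean
  of an untouched arm is 0 by division by zero.\<close>

lemma emp_mean_ge_iff: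
  assumes "s \<le> n" "seq_greedy k \<upsilon> Y s = i"
  shows "\<theta> \<le> emp_mean Y (snd (sg_run k \<upsilon> Y n)) i \<longleftrightarrow>
    0 \<le> arm_state (free_step \<theta>) (seq_greedy k \<upsilon>) i Y (Suc n)"
proof -
  let ?A = "{s. s < Suc n \<and> seq_greedy k \<upsilon> Y s = i}"
  have A: "{t. t < length (snd (sg_run k \<upsilon> Y n)) \<and> snd (sg_run k \<upsilon> Y n) ! t = i} = ?A"
    using sg_run_nth[of _ n k \<upsilon> Y] by auto
  have "s \<in> ?A" using assms by simp
  then have "card ?A > 0" by (subst card_gt_0_iff) auto
  then show ?thesis
    unfolding emp_mean_def A arm_state_free_step
    by (simp add: sum_subtractf pos_le_divide_eq mult.commute)
qed

lemma argmax_exists: "0 < k \<Longrightarrow> \<exists>j<k. \<forall>j'<k. (m j' :: real) \<le> m j" for k :: nat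
proof -
  assume "0 < k"
  then have "Max (m ` {..<k}) \<in> m ` {..<k}" by (intro Max_in) auto
  then obtain j where "j < k" "m j = Max (m ` {..<k})" by auto
  then show ?thesis by (intro exI[of _ j]) auto
qed

lemma least_argmax:
  fixes k :: nat and m :: "nat \<Rightarrow> real"
  assumes "0 < k"
  defines "a \<equiv> LEAST j. j < k \<and> (\<forall>j'<k. m j' \<le> m j)"
  shows "a < k" "\<And>j. j < k \<Longrightarrow> m j \<le> m a"
  using LeastI_ex[OF argmax_exists[OF assms(1), of m]] unfolding a_def by auto

text \<open>The index advances only when the mean of the current arm is below 1 - \<upsilon>, that
  is, when its walk is negative; killing makes this permanent. The walks are taken at
  \<open>Suc n\<close> because round \<open>n\<close> has already been played. That the arms up to
  the index are exactly those pulled makes every empirical mean compared later a genuine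
  one.\<close>

lemma sg_run_invariant:
  fixes k :: nat and \<upsilon> :: real and Y :: "nat \<times> nat \<Rightarrow> real"
  assumes "0 < k"
  defines "i \<equiv> \<lambda>n. fst (sg_run k \<upsilon> Y n)" and "pol \<equiv> seq_greedy k \<upsilon>"
  shows "i n < k \<and> (\<forall>s\<le>n. pol Y s \<le> i n) \<and> (\<forall>j\<le>i n. \<exists>s\<le>n. pol Y s = j) \<and>
    (\<forall>j<i n. arm_state (killed_step (1 - \<upsilon>)) pol j Y (Suc n) < 0)"
proof (induction n)
  case 0
  show ?case using assms(1) by (simp add: i_def pol_def seq_greedy_def)
next
  case (Suc n)
  let ?as = "snd (sg_run k \<upsilon> Y n)"
  obtain i0 as0 where run: "sg_run k \<upsilon> Y n = (i0, as0)" by fastforce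
  have i0: "i n = i0" and as0: "?as = as0" and len: "length as0 = Suc n"
    using run length_sg_run[of k \<upsilon> Y n] by (simp_all add: i_def)
  have pol: "pol Y (Suc n) = snd (sg_run k \<upsilon> Y (Suc n)) ! Suc n"
    by (simp add: pol_def seq_greedy_def)
  have killed: "\<forall>j<i0. arm_state (killed_step (1 - \<upsilon>)) pol j Y (Suc (Suc n)) < 0"
    using Suc i0 arm_state_killed_Suc_neg by auto
  consider (keep) "1 - \<upsilon> \<le> emp_mean Y as0 i0"
    | (switch) "\<not> 1 - \<upsilon> \<le> emp_mean Y as0 i0" "Suc i0 < k"
    | (fallback) "\<not> 1 - \<upsilon> \<le> emp_mean Y as0 i0" "\<not> Suc i0 < k" by blast
  then show ?case
  proof cases
    case keep
    then have "i (Suc n) = i0" "pol Y (Suc n) = i0"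
      using run len pol by (simp_all add: i_def nth_append)
    then show ?thesis using Suc i0 killed by (auto simp: le_Suc_eq)
  next
    case switch
    then have eq: "i (Suc n) = Suc i0" "pol Y (Suc n) = Suc i0"
      using run len pol by (simp_all add: i_def nth_append)
    obtain s where s: "s \<le> n" "pol Y s = i0" using Suc i0 by auto
    have "arm_state (free_step (1 - \<upsilon>)) pol i0 Y (Suc n) < 0"
      using emp_mean_ge_iff[of s n k \<upsilon> Y i0 "1 - \<upsilon>"] s switch(1) as0 unfolding pol_def by simp
    then have "arm_state (killed_step (1 - \<upsilon>)) pol i0 Y (Suc (Suc n)) < 0"
      by (intro arm_state_killed_Suc_neg arm_state_killed_neg)
    then show ?thesis using Suc i0 killed eq switch(2)
      by (auto simp: le_Suc_eq less_Suc_eq)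
  next
    case fallback
    then have eq: "i (Suc n) = i0"
        "pol Y (Suc n) = (LEAST j. j < k \<and> (\<forall>j'<k. emp_mean Y as0 j' \<le> emp_mean Y as0 j))"
      using run len pol by (simp_all add: i_def nth_append)
    have "pol Y (Suc n) < k"
      unfolding eq(2) by (rule least_argmax[OF assms(1)])
    then have "pol Y (Suc n) \<le> i0" using fallback(2) by simp
    then show ?thesis using Suc i0 killed eq(1) by (auto simp: le_Suc_eq)
  qed
qed

lemma seq_greedy_less: "0 < k \<Longrightarrow> seq_greedy k \<upsilon> Y t < k"
  using sg_run_invariant[of k \<upsilon> Y t] by (meson le_refl le_trans not_le order_le_less_trans)

text \<open>The only two facts about the policy that the regret bound uses. For the second: keeping
  an arm means its mean is at least 1 - \<upsilon>, a newly opened arm has state 0, and in the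
  argmax phase the chosen mean is at least that of any arm that survived the lower threshold
  \<theta>.\<close>

lemma seq_greedy_pull:
  fixes k :: nat and \<upsilon> \<theta> :: real
  assumes k: "0 < k" and \<theta>: "\<theta> \<le> 1 - \<upsilon>"
  defines "pol \<equiv> seq_greedy k \<upsilon>"
  shows "\<And>j. j < pol Y t \<Longrightarrow> arm_state (killed_step (1 - \<upsilon>)) pol j Y t < 0"
    and "(\<forall>j<k. arm_state (killed_step \<theta>) pol j Y t < 0) \<or> 0 \<le> arm_state (free_step \<theta>) pol (pol Y t) Y t"
proof -
  have "(\<forall>j<pol Y t. arm_state (killed_step (1 - \<upsilon>)) pol j Y t < 0) \<and>
    ((\<forall>j<k. arm_state (killed_step \<theta>) pol j Y t < 0) \<or> 0 \<le> arm_state (free_step \<theta>) pol (pol Y t) Y t)"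
  proof (cases t)
    case 0
    then show ?thesis by (simp add: pol_def seq_greedy_def)
  next
    case (Suc n)
    obtain i0 as0 where run: "sg_run k \<upsilon> Y n = (i0, as0)" by fastforce
    have as0: "snd (sg_run k \<upsilon> Y n) = as0" and len: "length as0 = Suc n"
      using run length_sg_run[of k \<upsilon> Y n] by simp_all
    have inv: "i0 < k" "\<forall>s\<le>n. pol Y s \<le> i0" "\<forall>j\<le>i0. \<exists>s\<le>n. pol Y s = j"
        "\<forall>j<i0. arm_state (killed_step (1 - \<upsilon>)) pol j Y (Suc n) < 0"
      using sg_run_invariant[OF k, of \<upsilon> Y n] run unfolding pol_def by auto
    have pol: "pol Y (Suc n) = snd (sg_run k \<upsilon> Y (Suc n)) ! Suc n"
      by (simp add: pol_def seq_greedy_def)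
    have mean: "x \<le> emp_mean Y as0 j \<longleftrightarrow> 0 \<le> arm_state (free_step x) pol j Y (Suc n)" if "j \<le> i0" for x j
      using inv(3) that emp_mean_ge_iff[of _ n k \<upsilon> Y j x] as0 unfolding pol_def by blast
    consider (keep) "1 - \<upsilon> \<le> emp_mean Y as0 i0"
      | (switch) "\<not> 1 - \<upsilon> \<le> emp_mean Y as0 i0" "Suc i0 < k"
      | (fallback) "\<not> 1 - \<upsilon> \<le> emp_mean Y as0 i0" "\<not> Suc i0 < k" by blast
    then show ?thesis
    proof cases
      case keep
      then have eq: "pol Y (Suc n) = i0" using run len pol by (simp add: nth_append)
      have "0 \<le> arm_state (free_step \<theta>) pol i0 Y (Suc n)"
        using mean[of i0 \<theta>] keep \<theta> by simp
      then show ?thesis using inv(4) eq Suc by simp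
    next
      case switch
      then have eq: "pol Y (Suc n) = Suc i0" using run len pol by (simp add: nth_append)
      \<comment> \<open>No pulls so far means state exactly 0, which counts as nonnegative.\<close>
      have never: "{s. s < Suc n \<and> pol Y s = Suc i0} = {}" using inv(2) by (auto simp: less_Suc_eq_le)
      then have free: "arm_state (free_step \<theta>) pol (Suc i0) Y (Suc n) = 0"
        unfolding arm_state_free_step never by simp
      have "arm_state (free_step (1 - \<upsilon>)) pol i0 Y (Suc n) < 0"
        using mean[of i0 "1 - \<upsilon>"] switch(1) by linarith
      then have "arm_state (killed_step (1 - \<upsilon>)) pol i0 Y (Suc n) < 0"
        by (rule arm_state_killed_neg)
      then show ?thesis using inv(4) unfolding Suc eq free by (auto simp: less_Suc_eq)
    next
      case fallback
      then have eq: "pol Y (Suc n) = (LEAST j. j < k \<and> (\<forall>j'<k. emp_mean Y as0 j' \<le> emp_mean Y as0 j))"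
        using run len pol by (simp add: nth_append)
      have a: "pol Y (Suc n) < k" "\<And>j. j < k \<Longrightarrow> emp_mean Y as0 j \<le> emp_mean Y as0 (pol Y (Suc n))"
        unfolding eq using least_argmax[OF k, where m = "emp_mean Y as0"] by auto
      have le: "j \<le> i0" if "j < k" for j using fallback(2) that by simp
      have "0 \<le> arm_state (free_step \<theta>) pol (pol Y (Suc n)) Y (Suc n)"
        if "j < k" "\<not> arm_state (killed_step \<theta>) pol j Y (Suc n) < 0" for j
      proof -
        have "0 \<le> arm_state (free_step \<theta>) pol j Y (Suc n)"
          using that(2) arm_state_killed_nonneg[of \<theta> pol j Y "Suc n"] by linarith
        then have "\<theta> \<le> emp_mean Y as0 j" using mean[OF le[OF that(1)]] by simp
        also have "\<dots> \<le> emp_mean Y as0 (pol Y (Suc n))" by (rule a(2)[OF that(1)])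
        finally show ?thesis using mean[OF le[OF a(1)]] by simp
      qed
      moreover have "arm_state (killed_step (1 - \<upsilon>)) pol j Y (Suc n) < 0" if "j < pol Y (Suc n)" for j
        using le[OF a(1)] that inv(4) by simp
      ultimately show ?thesis unfolding Suc by blast
    qed
  qed
  then show "\<And>j. j < pol Y t \<Longrightarrow> arm_state (killed_step (1 - \<upsilon>)) pol j Y t < 0"
    and "(\<forall>j<k. arm_state (killed_step \<theta>) pol j Y t < 0) \<or> 0 \<le> arm_state (free_step \<theta>) pol (pol Y t) Y t"
    by auto
qed

text \<open>Choosing the arm of round \<open>t\<close> consults empirical means over a history of
  length \<open>t\<close>, hence only rewards of rounds before \<open>t\<close>.\<close>

lemma sg_run_upd: "t \<le> s \<Longrightarrow> sg_run k \<upsilon> (Y((i, s) := y)) t = sg_run k \<upsilon> Y t"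
proof (induction t)
  case (Suc t)
  obtain i0 as0 where run: "sg_run k \<upsilon> Y t = (i0, as0)" by fastforce
  then have len: "length as0 = Suc t" using length_sg_run[of k \<upsilon> Y t] by simp
  have "emp_mean (Y((i, s) := y)) as0 = emp_mean Y as0"
    using Suc.prems len unfolding emp_mean_def by (intro ext arg_cong2[of _ _ _ _ "(/)"] sum.cong) auto
  then show ?case using Suc run by (simp del: fun_upd_apply)
qed simp

text \<open>The run takes values in a countable type, so it suffices to fix the previous state and
  check one step, where arm indices and history are constants.\<close>

lemma measurable_seq_greedy:
  assumes Y: "\<And>j. (\<lambda>Y. Y j) \<in> borel_measurable N"
  shows "(\<lambda>Y. seq_greedy k \<upsilon> Y t) \<in> N \<rightarrow>\<^sub>M count_space UNIV"
proof -
  have em: "(\<lambda>Y. emp_mean Y as i) \<in> borel_measurable N" for as i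
    unfolding emp_mean_def by (intro borel_measurable_divide borel_measurable_sum Y borel_measurable_const)
  have "(\<lambda>Y. sg_run k \<upsilon> Y n) \<in> N \<rightarrow>\<^sub>M count_space UNIV" for n
  proof (induction n)
    case (Suc n)
    define step where "step p Y = (case p of (i, as) \<Rightarrow>
      if emp_mean Y as i \<ge> 1 - \<upsilon> then (i, as @ [i])
      else if Suc i < k then (Suc i, as @ [Suc i])
      else (i, as @ [LEAST j. j < k \<and> (\<forall>j'<k. emp_mean Y as j' \<le> emp_mean Y as j)]))"
      for p :: "nat \<times> nat list" and Y
    have "step p \<in> N \<rightarrow>\<^sub>M count_space UNIV" for p
    proof -
      obtain i as where p: "p = (i, as)" by fastforce
      have le: "Measurable.pred N (\<lambda>Y. emp_mean Y as j' \<le> emp_mean Y as j)" for j j'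
        unfolding pred_def by (rule borel_measurable_le[OF em em])

      have "Measurable.pred N (\<lambda>Y. j < k \<and> (\<forall>j'<k. emp_mean Y as j' \<le> emp_mean Y as j))" for j
        by (intro pred_intros_conj1' pred_intros_countable pred_intros_imp' le)
      then have L: "(\<lambda>Y. LEAST j. j < k \<and> (\<forall>j'<k. emp_mean Y as j' \<le> emp_mean Y as j)) \<in> N \<rightarrow>\<^sub>M count_space UNIV"
        by (rule measurable_Least)
      have L': "(\<lambda>Y. (\<lambda>l. (i, as @ [l])) (LEAST j. j < k \<and> (\<forall>j'<k. emp_mean Y as j' \<le> emp_mean Y as j))) \<in> N \<rightarrow>\<^sub>M count_space UNIV"
        by (rule measurable_compose[OF L]) simp
      have thr: "{Y \<in> space N. 1 - \<upsilon> \<le> emp_mean Y as i} \<in> sets N"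
        by (rule borel_measurable_le[OF borel_measurable_const em])
      have "(\<lambda>Y. if 1 - \<upsilon> \<le> emp_mean Y as i then (i, as @ [i]) else h Y) \<in> N \<rightarrow>\<^sub>M count_space UNIV"
        if "h \<in> N \<rightarrow>\<^sub>M count_space UNIV" for h
        by (rule measurable_If[OF _ that thr]) simp
      then show ?thesis using L' unfolding p step_def[abs_def] prod.case
        by (cases "Suc i < k") (simp_all only: if_True if_False measurable_const space_count_space UNIV_I)
    qed
    from measurable_compose_countable[OF this Suc] show ?case
      by (simp add: step_def)
  qed simp
  from measurable_compose[OF this, of "\<lambda>p. snd p ! t" "count_space UNIV"] show ?thesis
    unfolding seq_greedy_def by simp
qed

section \<open>The regret bound for fixed means\<close>

lemma one_minus_exp_neg_ge:
  fixes x :: real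
  assumes "0 \<le> x" "x \<le> 1"
  shows "x / 2 \<le> 1 - exp (- x)"
proof -
  have "x / 2 * (1 + x) \<le> x" using assms mult_left_mono[of "1 + x" 2 x] by simp
  then have "x / 2 \<le> x / (1 + x)" using assms by (simp add: pos_le_divide_eq)
  also have "\<dots> = 1 - 1 / (1 + x)" using assms by (simp add: field_simps)
  also have "\<dots> \<le> 1 - 1 / exp x"
    using assms exp_ge_add_one_self[of x] by (intro diff_left_mono divide_left_mono) auto
  finally show ?thesis by (simp add: exp_minus inverse_eq_divide)
qed

text \<open>With exponent s, one pull multiplies the exponential by at most exp(s^2 / 2 - s
  (\<theta> - \<mu>)). The choice s = \<theta> - \<mu> minimises this, and the loss per pull is the
  fraction 1 - exp(- G^2 / 2).\<close>

lemma nn_integral_exp_free_step: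
  assumes sets: "sets Q = sets borel"
    and mgf: "\<And>s. 0 < s \<Longrightarrow> (\<integral>\<^sup>+x. ennreal (exp (s * (x - \<mu>))) \<partial>Q) \<le> ennreal (exp (s\<^sup>2 / 2))"
    and G: "G = \<theta> - \<mu>" "0 < G"
  shows "(\<integral>\<^sup>+y. ennreal (exp (G * free_step \<theta> x y)) \<partial>Q) + ennreal (1 - exp (- (G\<^sup>2 / 2))) * ennreal (exp (G * x))
    \<le> ennreal (exp (G * x))"
proof -
  have eq: "exp (G * free_step \<theta> x y) = exp (G * x) * exp (- G\<^sup>2) * exp (G * (y - \<mu>))" for y
    by (simp add: G algebra_simps power2_eq_square flip: exp_add)
  have "(\<integral>\<^sup>+y. ennreal (exp (G * free_step \<theta> x y)) \<partial>Q)
      = ennreal (exp (G * x) * exp (- G\<^sup>2)) * (\<integral>\<^sup>+y. ennreal (exp (G * (y - \<mu>))) \<partial>Q)"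
    unfolding eq by (subst nn_integral_cmult[symmetric])
      (auto simp: ennreal_mult measurable_cong_sets[OF sets refl])
  also have "\<dots> \<le> ennreal (exp (G * x) * exp (- G\<^sup>2)) * ennreal (exp (G\<^sup>2 / 2))"
    by (intro mult_left_mono mgf G) simp
  also have "\<dots> = ennreal (exp (- (G\<^sup>2 / 2)) * exp (G * x))"
    by (simp flip: ennreal_mult exp_add)
  finally have "(\<integral>\<^sup>+y. ennreal (exp (G * free_step \<theta> x y)) \<partial>Q) + ennreal (1 - exp (- (G\<^sup>2 / 2))) * ennreal (exp (G * x))
    \<le> ennreal (exp (- (G\<^sup>2 / 2)) * exp (G * x)) + ennreal ((1 - exp (- (G\<^sup>2 / 2))) * exp (G * x))"
    by (simp add: ennreal_mult add_right_mono)
  also have "\<dots> = ennreal (exp (G * x))"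
    by (subst ennreal_plus[symmetric]) (auto simp: algebra_simps)
  finally show ?thesis .
qed

text \<open>Each round is charged to one of three causes: every arm has fallen below the lower
  threshold, the pulled arm is within 4 \<delta>' of 1, or a worse arm \<open>i\<close> is pulled
  although its own walk is nonnegative, after all arms before it have dropped. The three terms bound
  these in this order.\<close>

lemma seq_greedy_regret_nn_integral:
  fixes Q :: "nat \<Rightarrow> real measure" and \<mu> :: "nat \<Rightarrow> real"
  assumes k: "0 < k" and prob: "\<And>i. prob_space (Q i)" and sets: "\<And>i. sets (Q i) = sets borel"
    and mgf: "\<And>i s. i < k \<Longrightarrow> 0 < s \<Longrightarrow>
      (\<integral>\<^sup>+x. ennreal (exp (s * (x - \<mu> i))) \<partial>Q i) \<le> ennreal (exp (s\<^sup>2 / 2))"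
    and \<mu>: "\<And>i. i < k \<Longrightarrow> 0 \<le> \<mu> i \<and> \<mu> i \<le> 1"
    and \<delta>: "0 < \<delta>" "\<delta> \<le> \<delta>'"
  shows "(\<Sum>t<T. \<integral>\<^sup>+Y. ennreal (1 - \<mu> (seq_greedy k (2 * \<delta>) Y t)) \<partial>PiM ({..<k} \<times> {..<T}) (\<lambda>(i, s). Q i))
    \<le> of_nat T * (\<Prod>j<k. ruin (Q j) (1 - 2 * \<delta>') 0) + of_nat T * ennreal (4 * \<delta>') +
      (\<Sum>i<k. ennreal (if 4 * \<delta>' < 1 - \<mu> i then 16 / (1 - \<mu> i) else 0) * (\<Prod>j<i. ruin (Q j) (1 - 2 * \<delta>) 0))"
proof -
  define pol where "pol = seq_greedy k (2 * \<delta>)"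
  define \<theta> where "\<theta> = 1 - 2 * \<delta>"
  define \<theta>' where "\<theta>' = 1 - 2 * \<delta>'"
  interpret adaptive_sampling k T Q pol
  proof (rule adaptive_sampling.intro)
    show "prob_space (Q i)" "sets (Q i) = sets borel" for i
      by (rule prob, rule sets)
    show "pol Y t < k" for Y t
      unfolding pol_def by (rule seq_greedy_less[OF k])
    show "pol (Y((i, s) := y)) t = pol Y t" if "t \<le> s" for Y i s t y
      using sg_run_upd[OF that] by (simp add: pol_def seq_greedy_def)
    show "(\<lambda>Y. pol Y t) \<in> PiM ({..<k} \<times> {..<T}) (\<lambda>(i, s). Q i) \<rightarrow>\<^sub>M count_space UNIV" for t
      unfolding pol_def by (intro measurable_seq_greedy measurable_reward_table sets)
  qed
  have rw: "real_walk (Q i)" for i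
    by (intro real_walkI prob sets)
  note ruin_measurable [measurable] = real_walk.measurable_ruin[OF rw]
  have prob_rewards: "prob_space rewards"
    by (rule prob_space_PiM) (auto simp: prob)
  have killed_meas: "(\<lambda>p. killed_step x (fst p) (snd p)) \<in> borel_measurable (borel \<Otimes>\<^sub>M borel)" for x
    unfolding killed_step_def by measurable
  have free_meas: "(\<lambda>p. free_step x (fst p) (snd p)) \<in> borel_measurable (borel \<Otimes>\<^sub>M borel)" for x
    by measurable
  \<comment> \<open>Two thresholds in one potential: the earlier arms are killed at \<theta>,
    because they were abandoned there, while the free walk of arm \<open>i\<close> is measured at
    \<theta>', because only that level is certain at a pull. Arms after \<open>i\<close> get the
    factor 1.\<close>
  define f where "f i j = (if j = i then free_step \<theta>' else killed_step \<theta>)" for i j :: nat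
  define G where "G i = \<theta>' - \<mu> i" for i
  define \<phi> :: "nat \<Rightarrow> nat \<Rightarrow> real \<Rightarrow> ennreal" where
    "\<phi> i j = (if j < i then ruin (Q j) \<theta> else if j = i then (\<lambda>x. ennreal (exp (G i * x))) else (\<lambda>_. 1))" for i j
  define w where "w i = (if 4 * \<delta>' < 1 - \<mu> i then 1 - \<mu> i else 0)" for i
  define A where "A t Y = (\<Prod>j<k. ruin (Q j) \<theta>' (arm_state (killed_step \<theta>') pol j Y t))" for t Y
  define B where "B i t Y = indicator {Y. pol Y t = i} Y * (\<Prod>j<k. \<phi> i j (arm_state (f i j) pol j Y t))" for i t Y
  have f_meas: "(\<lambda>p. f i j (fst p) (snd p)) \<in> borel_measurable (borel \<Otimes>\<^sub>M borel)" for i j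
    using killed_meas free_meas by (simp add: f_def)
  have \<phi>_meas [measurable]: "\<phi> i j \<in> borel_measurable borel" for i j
    by (simp add: \<phi>_def)
  have A_meas [measurable]: "A t \<in> borel_measurable rewards" for t
    using measurable_arm_state[OF killed_meas] unfolding A_def by measurable
  have B_meas [measurable]: "B i t \<in> borel_measurable rewards" for i t
  proof -
    note measurable_arm_state[OF f_meas, measurable]
    have "(\<lambda>Y. (if pol Y t = i then 1 else 0) * (\<Prod>j<k. \<phi> i j (arm_state (f i j) pol j Y t))) \<in> borel_measurable rewards"
      by measurable
    then show ?thesis by (simp add: B_def[abs_def] indicator_def)
  qed
  have pointwise: "ennreal (1 - \<mu> (pol Y t)) \<le> A t Y + ennreal (4 * \<delta>') + (\<Sum>i<k. ennreal (w i) * B i t Y)" for Y t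
  proof -
    let ?a = "pol Y t"
    have a: "?a < k" by (rule pol_less)
    have \<mu>a: "0 \<le> \<mu> ?a" "\<mu> ?a \<le> 1" using \<mu>[OF a] by auto
    have \<theta>\<theta>': "\<theta>' \<le> 1 - 2 * \<delta>" using \<delta> by (simp add: \<theta>'_def)
    note pull = seq_greedy_pull[OF k \<theta>\<theta>', folded pol_def \<theta>_def]
    from pull(2)[of Y t] show ?thesis
    proof
      assume "\<forall>j<k. arm_state (killed_step \<theta>') pol j Y t < 0"
      then have "A t Y = 1" unfolding A_def by (simp add: real_walk.ruin_neg[OF rw])
      moreover have "ennreal (1 - \<mu> ?a) \<le> 1" using \<mu>a by (simp add: ennreal_le_1)
      ultimately show ?thesis by (simp add: add.assoc add_increasing2)
    next
      assume nn: "0 \<le> arm_state (free_step \<theta>') pol ?a Y t"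
      show ?thesis
      proof (cases "4 * \<delta>' < 1 - \<mu> ?a")
        case False
        then have "ennreal (1 - \<mu> ?a) \<le> ennreal (4 * \<delta>')" by (intro ennreal_leI) simp
        then show ?thesis by (simp add: add_increasing add_increasing2)
      next
        case True
        then have wa: "w ?a = 1 - \<mu> ?a" by (simp add: w_def)
        have Ga: "0 \<le> G ?a" using True \<delta> by (simp add: G_def \<theta>'_def)
        \<comment> \<open>At a pull of a bad arm no factor is below 1: ruin is certain at the
          negative states of earlier arms, and the exponent of the pulled arm is
          nonnegative.\<close>
        have "1 \<le> (\<Prod>j<k. \<phi> ?a j (arm_state (f ?a j) pol j Y t))"
        proof (rule prod_ge_1)
          fix j assume "j \<in> {..<k}"
          show "1 \<le> \<phi> ?a j (arm_state (f ?a j) pol j Y t)"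
            using pull(1)[of j Y t] nn Ga real_walk.ruin_neg[OF rw]
            by (auto simp: \<phi>_def f_def ennreal_ge_1)
        qed
        then have "1 \<le> B ?a t Y" by (simp add: B_def)
        then have "ennreal (1 - \<mu> ?a) \<le> ennreal (w ?a) * B ?a t Y"
          using mult_left_mono[of 1 "B ?a t Y" "ennreal (w ?a)"] by (simp add: wa)
        also have "\<dots> \<le> (\<Sum>i<k. ennreal (w i) * B i t Y)"
          using a by (intro member_le_sum) auto
        finally show ?thesis by (simp add: add_increasing)
      qed
    qed
  qed
  have intA: "(\<integral>\<^sup>+Y. A t Y \<partial>rewards) \<le> (\<Prod>j<k. ruin (Q j) \<theta>' 0)" if "t \<le> T" for t
    using potential_bound[where f = "\<lambda>_. killed_step \<theta>'" and \<phi> = "\<lambda>j. ruin (Q j) \<theta>'" and e = "\<lambda>_. 0" and t = t, OF killed_meas] that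
    by (simp add: A_def real_walk.nn_integral_ruin_killed_step[OF rw])
  have intB: "ennreal (w i) * (\<Sum>t<T. \<integral>\<^sup>+Y. B i t Y \<partial>rewards)
      \<le> ennreal (if 4 * \<delta>' < 1 - \<mu> i then 16 / (1 - \<mu> i) else 0) * (\<Prod>j<i. ruin (Q j) \<theta> 0)" if i: "i < k" for i
  proof (cases "4 * \<delta>' < 1 - \<mu> i")
    case True
    define \<Delta> where "\<Delta> = 1 - \<mu> i"
    define c where "c = 1 - exp (- ((G i)\<^sup>2 / 2))"
    define e where "e j = (if j = i then ennreal c else 0)" for j
    have \<Delta>: "0 < \<Delta>" "\<Delta> \<le> 1" "4 * \<delta>' < \<Delta>" using True \<mu>[OF i] \<delta> by (auto simp: \<Delta>_def)
    \<comment> \<open>\<open>G i\<close> equals \<Delta> - 2 \<delta>', and 4 \<delta>' < \<Delta>: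
      the factor 4 leaves half of the gap between the mean and the lower threshold.\<close>
    have Gi: "\<Delta> / 2 < G i" "0 < G i" "G i \<le> 1"
      using \<Delta> \<mu>[OF i] \<delta> by (auto simp: G_def \<theta>'_def \<Delta>_def)
    have Gsq: "(\<Delta> / 2)\<^sup>2 \<le> (G i)\<^sup>2" "(G i)\<^sup>2 \<le> 1"
      using Gi \<Delta> by (auto intro!: power_mono power_le_one)
    \<comment> \<open>The 16 collects the square of the halved gap, the 1/2 in the exponent and the
      1/2 from linearising 1 - exp(- x).\<close>
    have "\<Delta>\<^sup>2 / 16 \<le> (G i)\<^sup>2 / 2 / 2" using Gsq by (simp add: power_divide)
    also have "\<dots> \<le> c" unfolding c_def using Gsq by (intro one_minus_exp_neg_ge) auto
    finally have c: "\<Delta>\<^sup>2 / 16 \<le> c" .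
    have eB: "e (pol Y t) * (\<Prod>j<k. \<phi> i j (arm_state (f i j) pol j Y t)) = ennreal c * B i t Y" for Y t
      by (simp add: e_def B_def)
    have step: "(\<integral>\<^sup>+y. \<phi> i j (f i j x y) \<partial>Q j) + e j * \<phi> i j x \<le> \<phi> i j x" for j x
    proof (cases "j = i")
      case True
      then show ?thesis
        using nn_integral_exp_free_step[OF sets mgf[OF i] G_def[of i] Gi(2), where x = x]
        by (simp add: \<phi>_def f_def e_def c_def G_def)
    next
      case False
      then show ?thesis
        using real_walk.nn_integral_ruin_killed_step[OF rw] prob_space.emeasure_space_1[OF prob[of j]]
        by (auto simp: \<phi>_def f_def e_def)
    qed
    have "(\<Sum>t<T. \<integral>\<^sup>+Y. ennreal c * B i t Y \<partial>rewards) \<le> (\<Prod>j<k. \<phi> i j 0)"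
      using potential_bound[OF f_meas \<phi>_meas step order_refl] unfolding eB
      by (rule order_trans[rotated]) (simp add: add_increasing)
    also have "(\<Prod>j<k. \<phi> i j 0) = (\<Prod>j<i. \<phi> i j 0)"
      using i by (intro prod.mono_neutral_right) (auto simp: \<phi>_def)
    also have "\<dots> = (\<Prod>j<i. ruin (Q j) \<theta> 0)" by (simp add: \<phi>_def)
    finally have S: "ennreal c * (\<Sum>t<T. \<integral>\<^sup>+Y. B i t Y \<partial>rewards) \<le> (\<Prod>j<i. ruin (Q j) \<theta> 0)"
      by (simp add: nn_integral_cmult sum_distrib_left)
    have "w i = 16 / \<Delta> * (\<Delta>\<^sup>2 / 16)"
      using True \<Delta> by (simp add: w_def \<Delta>_def[symmetric] power2_eq_square)
    then have "ennreal (w i) = ennreal (16 / \<Delta>) * ennreal (\<Delta>\<^sup>2 / 16)"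
      by (simp only:) (rule ennreal_mult, use \<Delta> in auto)
    then have "ennreal (w i) * (\<Sum>t<T. \<integral>\<^sup>+Y. B i t Y \<partial>rewards) =
        ennreal (16 / \<Delta>) * (ennreal (\<Delta>\<^sup>2 / 16) * (\<Sum>t<T. \<integral>\<^sup>+Y. B i t Y \<partial>rewards))"
      by (simp only: mult.assoc)
    also have "\<dots> \<le> ennreal (16 / \<Delta>) * (ennreal c * (\<Sum>t<T. \<integral>\<^sup>+Y. B i t Y \<partial>rewards))"
      using c by (intro mult_left_mono mult_right_mono ennreal_leI) auto
    also have "\<dots> \<le> ennreal (16 / \<Delta>) * (\<Prod>j<i. ruin (Q j) \<theta> 0)"
      by (intro mult_left_mono S) simp
    finally show ?thesis using True by (simp add: \<Delta>_def)
  qed (simp add: w_def)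
  have "(\<Sum>t<T. \<integral>\<^sup>+Y. ennreal (1 - \<mu> (pol Y t)) \<partial>rewards) \<le>
      (\<Sum>t<T. \<integral>\<^sup>+Y. A t Y + ennreal (4 * \<delta>') + (\<Sum>i<k. ennreal (w i) * B i t Y) \<partial>rewards)"
    by (intro sum_mono nn_integral_mono pointwise)
  also have "\<dots> = (\<Sum>t<T. (\<integral>\<^sup>+Y. A t Y \<partial>rewards) + ennreal (4 * \<delta>') + (\<Sum>i<k. ennreal (w i) * (\<integral>\<^sup>+Y. B i t Y \<partial>rewards)))"
    using prob_space.emeasure_space_1[OF prob_rewards]
    by (intro sum.cong refl) (simp add: nn_integral_add nn_integral_sum nn_integral_cmult)
  also have "\<dots> = (\<Sum>t<T. \<integral>\<^sup>+Y. A t Y \<partial>rewards) + of_nat T * ennreal (4 * \<delta>') +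
      (\<Sum>i<k. ennreal (w i) * (\<Sum>t<T. \<integral>\<^sup>+Y. B i t Y \<partial>rewards))"
    by (simp add: sum.distrib sum_distrib_left sum.swap[of _ "{..<k}"])
  also have "\<dots> \<le> of_nat T * (\<Prod>j<k. ruin (Q j) \<theta>' 0) + of_nat T * ennreal (4 * \<delta>') +
      (\<Sum>i<k. ennreal (if 4 * \<delta>' < 1 - \<mu> i then 16 / (1 - \<mu> i) else 0) * (\<Prod>j<i. ruin (Q j) \<theta> 0))"
  proof (intro add_mono sum_mono order_refl)
    show "(\<Sum>t<T. \<integral>\<^sup>+Y. A t Y \<partial>rewards) \<le> of_nat T * (\<Prod>j<k. ruin (Q j) \<theta>' 0)"
      using sum_bounded_above[of "{..<T}" "\<lambda>t. \<integral>\<^sup>+Y. A t Y \<partial>rewards", OF intA] by simp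
  qed (use intB in auto)
  finally show ?thesis unfolding pol_def \<theta>_def \<theta>'_def .
qed

section \<open>Bayesian regret\<close>

locale reward_kernel =
  fixes P :: "real \<Rightarrow> real measure"
  assumes prob_P: "\<And>m. 0 \<le> m \<Longrightarrow> m \<le> 1 \<Longrightarrow> prob_space (P m)"
    and sets_P: "\<And>m. 0 \<le> m \<Longrightarrow> m \<le> 1 \<Longrightarrow> sets (P m) = sets borel"
    and mgf_P: "\<And>m s. 0 \<le> m \<Longrightarrow> m \<le> 1 \<Longrightarrow> 0 < s \<Longrightarrow>
      (\<integral>\<^sup>+x. ennreal (exp (s * (x - m))) \<partial>P m) \<le> ennreal (exp (s\<^sup>2 / 2))"
begin

lemma cond_regret_le_trivial:
  assumes k: "0 < k" and \<mu>: "\<And>i. i < k \<Longrightarrow> 0 \<le> \<mu> i \<and> \<mu> i \<le> 1"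
  shows "cond_regret P T k (seq_greedy k \<upsilon>) \<mu> \<le> real T"
proof -
  have "Max (\<mu> ` {..<k}) \<le> 1" using k \<mu> by (subst Max_le_iff) auto
  then have "real T * Max (\<mu> ` {..<k}) \<le> real T * 1" by (intro mult_left_mono) auto
  moreover have "0 \<le> (\<Sum>t<T. \<integral>Y. \<mu> (seq_greedy k \<upsilon> Y t) \<partial>(PiM ({..<k} \<times> {..<T}) (\<lambda>(i, s). P (\<mu> i))))"
    using \<mu>[OF seq_greedy_less[OF k]] by (intro sum_nonneg integral_nonneg) auto
  ultimately show ?thesis unfolding cond_regret_def by simp
qed

text \<open>Ruin from 0 is one minus survival, hence at most 1 - p for an arm of mean at least 1 -
  \<delta> and at most 1 otherwise. The bound becomes a combination of products of functions of
  single means, ready to be integrated over an i.i.d. prior.\<close>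

lemma cond_regret_le:
  assumes k: "0 < k" and \<mu>: "\<And>i. i < k \<Longrightarrow> 0 \<le> \<mu> i \<and> \<mu> i \<le> 1"
    and \<delta>: "0 < \<delta>" "\<delta> \<le> \<delta>'" and p: "p \<le> 1" "p' \<le> 1"
    and surv: "\<And>m. 0 \<le> m \<Longrightarrow> m \<le> 1 \<Longrightarrow> 1 - \<delta> \<le> m \<Longrightarrow> p \<le> survival_prob (P m) (1 - 2 * \<delta>)"
    and surv': "\<And>m. 0 \<le> m \<Longrightarrow> m \<le> 1 \<Longrightarrow> 1 - \<delta>' \<le> m \<Longrightarrow> p' \<le> survival_prob (P m) (1 - 2 * \<delta>')"
  shows "cond_regret P T k (seq_greedy k (2 * \<delta>)) \<mu> \<le>
    real T * (\<Prod>j<k. 1 - p' * indicator {1 - \<delta>'..} (\<mu> j)) + real T * (4 * \<delta>') +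
    (\<Sum>i<k. (if 4 * \<delta>' < 1 - \<mu> i then 16 / (1 - \<mu> i) else 0) * (\<Prod>j<i. 1 - p * indicator {1 - \<delta>..} (\<mu> j)))"
    (is "_ \<le> ?bound")
proof -
  \<comment> \<open>Arms beyond \<open>k\<close> get a dummy law, so that every index carries a
    probability measure; the reward table is unaffected.\<close>
  define Q where "Q i = (if i < k then P (\<mu> i) else return borel 0)" for i
  have prob: "prob_space (Q i)" and sets: "sets (Q i) = sets borel" for i
    using \<mu>[of i] prob_P sets_P by (auto simp: Q_def prob_space_return)
  have mgf: "(\<integral>\<^sup>+x. ennreal (exp (s * (x - \<mu> i))) \<partial>Q i) \<le> ennreal (exp (s\<^sup>2 / 2))" if "i < k" "0 < s" for i s
    using that \<mu>[of i] mgf_P by (auto simp: Q_def)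
  let ?R = "PiM ({..<k} \<times> {..<T}) (\<lambda>(i, s). Q i)"
  have R: "PiM ({..<k} \<times> {..<T}) (\<lambda>(i, s). P (\<mu> i)) = ?R"
    by (rule PiM_cong) (auto simp: Q_def)
  interpret R: prob_space ?R
    by (rule prob_space_PiM) (auto simp: prob)
  let ?pol = "seq_greedy k (2 * \<delta>)"
  have pol_meas [measurable]: "(\<lambda>Y. ?pol Y t) \<in> ?R \<rightarrow>\<^sub>M count_space UNIV" for t
    by (intro measurable_seq_greedy measurable_reward_table sets)
  have \<mu>pol: "0 \<le> \<mu> (?pol Y t)" "\<mu> (?pol Y t) \<le> 1" for Y t
    using \<mu>[OF seq_greedy_less[OF k]] by auto
  have int: "integrable ?R (\<lambda>Y. \<mu> (?pol Y t))" for t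
    by (rule R.integrable_const_bound[of _ 1]) (use \<mu>pol in auto)
  have rw: "real_walk (Q i)" for i
    by (intro real_walkI prob sets)
  have ruin: "ruin (Q j) (1 - 2 * d) 0 \<le> ennreal (1 - q * indicator {1 - d..} (\<mu> j))"
    if "j < k" and s: "\<And>m. 0 \<le> m \<Longrightarrow> m \<le> 1 \<Longrightarrow> 1 - d \<le> m \<Longrightarrow> q \<le> survival_prob (P m) (1 - 2 * d)" for j d q
  proof -
    have "0 \<le> survival_prob (Q j) (1 - 2 * d)" by (simp add: survival_prob_def)
    then show ?thesis
      using s[of "\<mu> j"] \<mu>[of j] \<open>j < k\<close> unfolding real_walk.ruin_0[OF rw]
      by (intro ennreal_leI) (auto simp: Q_def indicator_def)
  qed
  have nn: "0 \<le> 1 - p * indicator {1 - \<delta>..} m" "0 \<le> 1 - p' * indicator {1 - \<delta>'..} m" for m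
    using p by (auto simp: indicator_def)
  have prods: "(\<Prod>j<k. ruin (Q j) (1 - 2 * \<delta>') 0) \<le> ennreal (\<Prod>j<k. 1 - p' * indicator {1 - \<delta>'..} (\<mu> j))"
      "\<And>i. i < k \<Longrightarrow> (\<Prod>j<i. ruin (Q j) (1 - 2 * \<delta>) 0) \<le> ennreal (\<Prod>j<i. 1 - p * indicator {1 - \<delta>..} (\<mu> j))"
    using ruin[OF _ surv] ruin[OF _ surv'] nn by (auto simp: prod_ennreal[symmetric] intro!: prod_mono_ennreal)
  have pos: "0 \<le> (if 4 * \<delta>' < 1 - \<mu> i then 16 / (1 - \<mu> i) else 0)" for i
    using \<delta> by auto
  have bound_nonneg: "0 \<le> ?bound"
    using \<delta> nn pos by (intro add_nonneg_nonneg mult_nonneg_nonneg sum_nonneg prod_nonneg) auto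
  have "ennreal (\<Sum>t<T. \<integral>Y. 1 - \<mu> (?pol Y t) \<partial>?R) = (\<Sum>t<T. \<integral>\<^sup>+Y. ennreal (1 - \<mu> (?pol Y t)) \<partial>?R)"
  proof -
    have "(\<integral>\<^sup>+Y. ennreal (1 - \<mu> (?pol Y t)) \<partial>?R) = ennreal (\<integral>Y. 1 - \<mu> (?pol Y t) \<partial>?R)" for t
      by (rule nn_integral_eq_integral) (use int \<mu>pol in auto)
    moreover have "0 \<le> (\<integral>Y. 1 - \<mu> (?pol Y t) \<partial>?R)" for t
      by (rule integral_nonneg_AE) (use \<mu>pol in auto)
    ultimately show ?thesis by (simp only: sum_ennreal)
  qed
  also have "\<dots> \<le> of_nat T * (\<Prod>j<k. ruin (Q j) (1 - 2 * \<delta>') 0) + of_nat T * ennreal (4 * \<delta>') +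
      (\<Sum>i<k. ennreal (if 4 * \<delta>' < 1 - \<mu> i then 16 / (1 - \<mu> i) else 0) * (\<Prod>j<i. ruin (Q j) (1 - 2 * \<delta>) 0))"
    by (rule seq_greedy_regret_nn_integral[OF k prob sets mgf \<mu> \<delta>])
  also have "\<dots> \<le> of_nat T * ennreal (\<Prod>j<k. 1 - p' * indicator {1 - \<delta>'..} (\<mu> j)) + of_nat T * ennreal (4 * \<delta>') +
      (\<Sum>i<k. ennreal (if 4 * \<delta>' < 1 - \<mu> i then 16 / (1 - \<mu> i) else 0) *
        ennreal (\<Prod>j<i. 1 - p * indicator {1 - \<delta>..} (\<mu> j)))"
    using prods by (intro add_mono mult_left_mono sum_mono) auto
  also have "\<dots> = ennreal ?bound"
    using \<delta> nn pos
    by (simp add: ennreal_of_nat_eq_real_of_nat ennreal_mult[symmetric] sum_ennreal prod_nonneg sum_nonneg ennreal_plus[symmetric]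
      del: ennreal_plus)
  finally have "(\<Sum>t<T. \<integral>Y. 1 - \<mu> (?pol Y t) \<partial>?R) \<le> ?bound"
    using bound_nonneg by (simp add: ennreal_le_iff)
  moreover have "cond_regret P T k ?pol \<mu> \<le> (\<Sum>t<T. \<integral>Y. 1 - \<mu> (?pol Y t) \<partial>?R)"
  proof -
    have "Max (\<mu> ` {..<k}) \<le> 1" using k \<mu> by (subst Max_le_iff) auto
    then have "real T * Max (\<mu> ` {..<k}) \<le> real T * 1" by (intro mult_left_mono) auto
    then show ?thesis unfolding cond_regret_def R
      using int by (simp add: Bochner_Integration.integral_diff R.prob_space sum_subtractf)
  qed
  ultimately show ?thesis by simp
qed

end

text \<open>The integral of a non-integrable function is \<open>0\<close>; this is where \<open>0 \<le> b\<close> enters.\<close>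

lemma nonneg_bound_integral:
  assumes "AE x in M. f x \<le> h x" "integrable M h" "integral\<^sup>L M h \<le> b" "0 \<le> b"
  shows "integral\<^sup>L M f \<le> (b :: real)"
proof (cases "integrable M f")
  case True
  then show ?thesis using integral_mono_AE[OF True assms(2,1)] assms(3) by simp
qed (simp add: not_integrable_integral_eq assms(4))

text \<open>For the largest \<open>l\<close> with 1 - m \<le> 2^(-l), the gap exceeds 2^(-l-1), so
  the term of index \<open>l\<close> alone suffices. The right-hand side is a combination of upper
  tail indicators, which is what 1-regularity controls.\<close>

lemma dyadic_reciprocal_bound:
  fixes \<epsilon> m :: real
  assumes "(1/2) ^ M \<le> \<epsilon>" "0 < \<epsilon>" "0 \<le> m"
  shows "(if \<epsilon> < 1 - m then 16 / (1 - m) else 0) \<le> (\<Sum>l\<le>M. 32 * 2 ^ l * indicator {1 - (1/2) ^ l..} m)"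
proof (cases "\<epsilon> < 1 - m")
  case True
  define L where "L = {l. l \<le> M \<and> 1 - m \<le> (1/2) ^ l}"
  define l where "l = Max L"
  have "finite L" "0 \<in> L" using assms by (auto simp: L_def)
  then have l: "l \<in> L" and max: "\<And>l'. l' \<in> L \<Longrightarrow> l' \<le> l"
    unfolding l_def by (auto intro: Max_in)
  have "l < M" using l assms(1) True by (cases "l = M") (auto simp: L_def)
  then have "(1/2) ^ Suc l < 1 - m"
  proof (rule contrapos_pp)
    assume "\<not> (1/2) ^ Suc l < 1 - m"
    then have "Suc l \<in> L" using \<open>l < M\<close> by (simp add: L_def not_less del: power_Suc)
    then show "\<not> l < M" using max[of "Suc l"] by simp
  qed
  then have "16 / (1 - m) \<le> 16 / (1/2) ^ Suc l"
    using assms True by (intro divide_left_mono) auto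
  also have "\<dots> = 32 * 2 ^ l * indicator {1 - (1/2) ^ l..} m"
    using l by (simp add: L_def power_divide)
  also have "\<dots> \<le> (\<Sum>l\<le>M. 32 * 2 ^ l * indicator {1 - (1/2) ^ l..} m)"
    using \<open>l < M\<close> by (intro member_le_sum) auto
  finally show ?thesis using True by simp
qed (auto intro: sum_nonneg)

lemma exists_dyadic:
  fixes \<delta> :: real
  assumes "0 < \<delta>" "\<delta> \<le> 1"
  obtains M :: nat where "(1/2) ^ M \<le> \<delta>" "real M + 1 \<le> 2 * (1 + ln (1 / \<delta>))"
proof
  define x where "x = ln (1 / \<delta>)"
  \<comment> \<open>The factor 2 comes from using exp(1/2) \<le> 2 in place of the base-2
    logarithm.\<close>
  define M where "M = nat \<lceil>2 * x\<rceil>"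
  have "0 \<le> x" using assms by (simp add: x_def)
  then have M: "2 * x \<le> real M" "real M < 2 * x + 1"
    using ceiling_correct[of "2 * x"] by (simp_all add: M_def)
  show "real M + 1 \<le> 2 * (1 + ln (1 / \<delta>))"
    unfolding x_def[symmetric] using M by simp
  have "1 / \<delta> = exp x" using assms by (simp add: x_def)
  also have "\<dots> \<le> exp (real M * (1/2))" using M by simp
  also have "\<dots> = exp (1/2) ^ M" by (rule exp_of_nat_mult)
  also have "\<dots> \<le> 2 ^ M" by (intro power_mono exp_half_le2) auto
  finally show "(1/2) ^ M \<le> \<delta>" using assms by (simp add: field_simps power_divide)
qed

lemma sum_power_le_inverse:
  fixes c :: real
  assumes "0 < c" "c \<le> 1"
  shows "(\<Sum>i<k. (1 - c) ^ i) \<le> 1 / c"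
proof -
  have "(\<Sum>i<k. (1 - c) ^ i) = (1 - (1 - c) ^ k) / c"
    using assms by (subst sum_gp_strict) auto
  also have "\<dots> \<le> 1 / c" using assms by (intro divide_right_mono) auto
  finally show ?thesis .
qed

section \<open>Averaging over a 1-regular prior\<close>

locale regular_prior = reward_kernel P for P +
  fixes \<Gamma> :: "real measure" and c0 C0 :: real
  assumes prob_\<Gamma>: "prob_space \<Gamma>" and sets_\<Gamma> [simp, measurable_cong]: "sets \<Gamma> = sets borel"
    and unit: "measure \<Gamma> {0..1} = 1"
    and c0: "0 < c0"
    and lower: "\<And>\<epsilon>. 0 < \<epsilon> \<Longrightarrow> \<epsilon> \<le> 1 \<Longrightarrow> c0 * \<epsilon> \<le> measure \<Gamma> {1 - \<epsilon>..}"
    and upper: "\<And>\<epsilon>. 0 < \<epsilon> \<Longrightarrow> \<epsilon> \<le> 1 \<Longrightarrow> measure \<Gamma> {1 - \<epsilon>..} \<le> C0 * \<epsilon>"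
begin

sublocale \<Gamma>: prob_space \<Gamma> by (rule prob_\<Gamma>)

lemma C0_nonneg: "0 \<le> C0"
  using lower[of 1] upper[of 1] c0 by simp

lemma AE_unit: "AE m in \<Gamma>. 0 \<le> m \<and> m \<le> 1"
  using \<Gamma>.prob_eq_1[of "{0..1}"] unit by simp

abbreviation means :: "nat \<Rightarrow> (nat \<Rightarrow> real) measure" where
  "means k \<equiv> PiM {..<k} (\<lambda>_. \<Gamma>)"

lemma AE_means: "AE \<mu> in means k. \<forall>i\<in>{..<k}. 0 \<le> \<mu> i \<and> \<mu> i \<le> 1"
  by (intro AE_finite_allI AE_PiM_component[of "{..<k}" "\<lambda>_. \<Gamma>"] prob_\<Gamma> AE_unit) auto

text \<open>The dyadic tail at level \<open>l\<close> has weight 32 * 2^l and probability at most C0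
  / 2^l, so every level contributes the same constant and only the logarithmic number of levels
  remains.\<close>

lemma integral_reciprocal_le:
  assumes \<epsilon>: "0 < \<epsilon>" "\<epsilon> \<le> 1"
  defines "h \<equiv> \<lambda>m. if 4 * \<epsilon> < 1 - m then 16 / (1 - m) else 0"
  shows "integrable \<Gamma> h" and "integral\<^sup>L \<Gamma> h \<le> 64 * C0 * (1 + ln (1 / \<epsilon>))"
proof -
  have h_meas: "h \<in> borel_measurable \<Gamma>" unfolding h_def by measurable
  have "norm (h m) \<le> 4 / \<epsilon>" for m
  proof (cases "4 * \<epsilon> < 1 - m")
    case True
    then have "16 / (1 - m) \<le> 16 / (4 * \<epsilon>)" using \<epsilon> by (intro divide_left_mono) auto
    then show ?thesis using True \<epsilon> by (simp add: h_def)
  qed (use \<epsilon> in \<open>simp add: h_def\<close>)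
  then show int: "integrable \<Gamma> h" by (intro \<Gamma>.integrable_const_bound[OF _ h_meas]) auto
  obtain M :: nat where M: "(1/2) ^ M \<le> \<epsilon>" "real M + 1 \<le> 2 * (1 + ln (1 / \<epsilon>))"
    using exists_dyadic[OF \<epsilon>] .
  define H where "H m = (\<Sum>l\<le>M. 32 * 2 ^ l * indicator {1 - (1/2) ^ l..} m :: real)" for m :: real
  have intH: "integrable \<Gamma> H" unfolding H_def
    by (intro Bochner_Integration.integrable_sum integrable_mult_right integrable_real_indicator)
      (auto simp: \<Gamma>.emeasure_eq_measure)
  have "integral\<^sup>L \<Gamma> h \<le> integral\<^sup>L \<Gamma> H"
  proof (rule integral_mono_AE[OF int intH])
    show "AE m in \<Gamma>. h m \<le> H m"
      using AE_unit
    proof eventually_elim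
      case (elim m)
      then show ?case using dyadic_reciprocal_bound[of M "4 * \<epsilon>" m] M(1) \<epsilon> by (simp add: h_def H_def)
    qed
  qed
  also have "\<dots> = (\<Sum>l\<le>M. 32 * 2 ^ l * measure \<Gamma> {1 - (1/2) ^ l..})"
    unfolding H_def
    by (subst Bochner_Integration.integral_sum) (auto simp: \<Gamma>.emeasure_eq_measure intro!: integrable_mult_right integrable_real_indicator)
  also have "\<dots> \<le> (\<Sum>l\<le>M. 32 * C0)"
  proof (rule sum_mono)
    fix l
    have "measure \<Gamma> {1 - (1/2) ^ l..} \<le> C0 * (1/2) ^ l"
      by (rule upper) (auto simp: power_le_one)
    then have "32 * 2 ^ l * measure \<Gamma> {1 - (1/2) ^ l..} \<le> 32 * 2 ^ l * (C0 * (1/2) ^ l)"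
      by (intro mult_left_mono) auto
    then show "32 * 2 ^ l * measure \<Gamma> {1 - (1/2) ^ l..} \<le> 32 * C0"
      by (simp add: power_divide)
  qed
  also have "\<dots> = 32 * C0 * (real M + 1)" by simp
  also have "\<dots> \<le> 32 * C0 * (2 * (1 + ln (1 / \<epsilon>)))"
    using M(2) C0_nonneg by (intro mult_left_mono) auto
  finally show "integral\<^sup>L \<Gamma> h \<le> 64 * C0 * (1 + ln (1 / \<epsilon>))" by (simp add: algebra_simps)
qed

lemma bayes_regret_le_trivial:
  assumes "0 < k"
  shows "bayes_regret P \<Gamma> T k (seq_greedy k \<upsilon>) \<le> real T"
proof -
  interpret M: prob_space "means k" by (rule prob_space_PiM) (rule prob_\<Gamma>)
  show ?thesis unfolding bayes_regret_def
  proof (rule nonneg_bound_integral[where h = "\<lambda>_. real T"])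
    show "AE \<mu> in means k. cond_regret P T k (seq_greedy k \<upsilon>) \<mu> \<le> real T"
      using AE_means by eventually_elim (use cond_regret_le_trivial[OF assms] in auto)
  qed (auto simp: M.prob_space)
qed

lemma integral_prod_means:
  assumes "\<And>j. j < k \<Longrightarrow> integrable \<Gamma> (u j)"
  shows "integrable (means k) (\<lambda>\<mu>. \<Prod>j<k. u j (\<mu> j) :: real)"
    and "(\<integral>\<mu>. (\<Prod>j<k. u j (\<mu> j)) \<partial>means k) = (\<Prod>j<k. integral\<^sup>L \<Gamma> (u j))"
proof -
  interpret product_sigma_finite "\<lambda>_::nat. \<Gamma>"
    by (intro product_sigma_finite.intro) (rule \<Gamma>.sigma_finite_measure_axioms)
  show "integrable (means k) (\<lambda>\<mu>. \<Prod>j<k. u j (\<mu> j))"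
    by (rule product_integrable_prod) (use assms in auto)
  show "(\<integral>\<mu>. (\<Prod>j<k. u j (\<mu> j)) \<partial>means k) = (\<Prod>j<k. integral\<^sup>L \<Gamma> (u j))"
    by (rule product_integral_prod) (use assms in auto)
qed

text \<open>By independence of the means, the first product averages to a \<open>k\<close>-th power
  and is bounded by an exponential. The mean of arm \<open>i\<close> is independent of those of the
  arms before it, so the last sum is the reciprocal integral times a geometric series of ratio at
  most 1 - c0 p \<delta>.\<close>

lemma bayes_regret_le:
  assumes k: "0 < k" and \<delta>: "0 < \<delta>" "\<delta> \<le> \<delta>'" "\<delta>' \<le> 1" and p: "0 < p" "p \<le> 1" "0 < p'" "p' \<le> 1"
    and surv: "\<And>m. 0 \<le> m \<Longrightarrow> m \<le> 1 \<Longrightarrow> 1 - \<delta> \<le> m \<Longrightarrow> p \<le> survival_prob (P m) (1 - 2 * \<delta>)"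
    and surv': "\<And>m. 0 \<le> m \<Longrightarrow> m \<le> 1 \<Longrightarrow> 1 - \<delta>' \<le> m \<Longrightarrow> p' \<le> survival_prob (P m) (1 - 2 * \<delta>')"
  shows "bayes_regret P \<Gamma> T k (seq_greedy k (2 * \<delta>)) \<le>
    real T * exp (- (real k * (c0 * p' * \<delta>'))) + 4 * real T * \<delta>' +
      64 * C0 * (1 + ln (1 / \<delta>')) / (c0 * p * \<delta>)"
proof -
  interpret M: prob_space "means k" by (rule prob_space_PiM) (rule prob_\<Gamma>)
  define u where "u q d m = 1 - q * indicator {1 - d..} m" for q d m :: real
  define h where "h m = (if 4 * \<delta>' < 1 - m then 16 / (1 - m) else 0)" for m :: real
  have \<delta>'0: "0 < \<delta>'" using \<delta> by simp
  note h = integral_reciprocal_le[OF \<delta>'0 \<delta>(3), folded h_def[abs_def]]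
  have h0: "0 \<le> integral\<^sup>L \<Gamma> h" using \<delta>'0 by (intro integral_nonneg_AE) (auto simp: h_def)
  have u_int: "integrable \<Gamma> (u q d)" for q d
    unfolding u_def by (auto simp: \<Gamma>.emeasure_eq_measure intro!: Bochner_Integration.integrable_diff integrable_mult_right integrable_real_indicator)
  have u_val: "integral\<^sup>L \<Gamma> (u q d) = 1 - q * measure \<Gamma> {1 - d..}" for q d
    unfolding u_def by (subst Bochner_Integration.integral_diff)
      (auto simp: \<Gamma>.emeasure_eq_measure \<Gamma>.prob_space intro!: integrable_mult_right integrable_real_indicator)
  have u_le: "integral\<^sup>L \<Gamma> (u q d) \<le> 1 - c0 * q * d" "0 \<le> integral\<^sup>L \<Gamma> (u q d)"
    if "0 < q" "q \<le> 1" "0 < d" "d \<le> 1" for q d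
  proof -
    have "q * (c0 * d) \<le> q * measure \<Gamma> {1 - d..}"
      using that lower[of d] by (intro mult_left_mono) auto
    then show "integral\<^sup>L \<Gamma> (u q d) \<le> 1 - c0 * q * d" unfolding u_val by (simp add: mult_ac)
    show "0 \<le> integral\<^sup>L \<Gamma> (u q d)"
      unfolding u_val using mult_mono[of q 1 "measure \<Gamma> {1 - d..}" 1] that \<Gamma>.prob_le_1 by auto
  qed
  note uI = u_le[OF p(1,2) \<delta>(1) order_trans[OF \<delta>(2,3)]] and uI' = u_le[OF p(3,4) \<delta>'0 \<delta>(3)]
  \<comment> \<open>Padding with the constant 1 beyond \<open>i\<close> writes each summand as a
    product over all \<open>k\<close> coordinates, to which the product integral formula
    applies.\<close>
  define F where "F i j = (if j < i then u p \<delta> else if j = i then h else (\<lambda>_. 1))" for i j :: nat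
  have F_int: "integrable \<Gamma> (F i j)" for i j
    using u_int h(1) by (simp add: F_def)
  have F_prod: "(\<Prod>j<k. F i j (\<mu> j)) = h (\<mu> i) * (\<Prod>j<i. u p \<delta> (\<mu> j))" if "i < k" for i \<mu>
  proof -
    have "(\<Prod>j<k. F i j (\<mu> j)) = (\<Prod>j<Suc i. F i j (\<mu> j))"
      using that by (intro prod.mono_neutral_right) (auto simp: F_def)
    then show ?thesis by (simp add: F_def mult.commute)
  qed
  have F_val: "(\<Prod>j<k. integral\<^sup>L \<Gamma> (F i j)) = integral\<^sup>L \<Gamma> h * integral\<^sup>L \<Gamma> (u p \<delta>) ^ i" if "i < k" for i
  proof -
    have "(\<Prod>j<k. integral\<^sup>L \<Gamma> (F i j)) = (\<Prod>j<Suc i. integral\<^sup>L \<Gamma> (F i j))"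
      using that by (intro prod.mono_neutral_right) (auto simp: F_def \<Gamma>.prob_space)
    then show ?thesis by (simp add: F_def mult.commute)
  qed
  let ?c = "c0 * p * \<delta>" and ?c' = "c0 * p' * \<delta>'"
  have c: "0 < ?c" "?c \<le> 1" using uI c0 p \<delta> by auto
  define bound where "bound \<mu> = real T * (\<Prod>j<k. u p' \<delta>' (\<mu> j)) + real T * (4 * \<delta>') +
      (\<Sum>i<k. \<Prod>j<k. F i j (\<mu> j))" for \<mu>
  have bound_int: "integrable (means k) bound"
    unfolding bound_def
    by (intro Bochner_Integration.integrable_add Bochner_Integration.integrable_sum integrable_mult_right integral_prod_means u_int F_int) auto
  have "integral\<^sup>L (means k) bound = real T * integral\<^sup>L \<Gamma> (u p' \<delta>') ^ k + real T * (4 * \<delta>') +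
      (\<Sum>i<k. integral\<^sup>L \<Gamma> h * integral\<^sup>L \<Gamma> (u p \<delta>) ^ i)"
    unfolding bound_def using integral_prod_means[OF u_int] integral_prod_means[OF F_int] F_val
    by (simp add: Bochner_Integration.integral_add Bochner_Integration.integral_sum M.prob_space)
  also have "\<dots> \<le> real T * exp (- (real k * ?c')) + 4 * real T * \<delta>' + 64 * C0 * (1 + ln (1 / \<delta>')) / ?c"
  proof (intro add_mono)
    have "integral\<^sup>L \<Gamma> (u p' \<delta>') ^ k \<le> exp (- ?c') ^ k"
      using uI' exp_ge_add_one_self[of "- ?c'"] by (intro power_mono) auto
    also have "\<dots> = exp (- (real k * ?c'))" by (simp add: exp_of_nat_mult[symmetric])
    finally show "real T * integral\<^sup>L \<Gamma> (u p' \<delta>') ^ k \<le> real T * exp (- (real k * ?c'))"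
      by (intro mult_left_mono) auto
    have "(\<Sum>i<k. integral\<^sup>L \<Gamma> h * integral\<^sup>L \<Gamma> (u p \<delta>) ^ i) \<le> integral\<^sup>L \<Gamma> h * (\<Sum>i<k. (1 - ?c) ^ i)"
      unfolding sum_distrib_left using uI h0 by (intro sum_mono mult_left_mono power_mono) auto
    also have "\<dots> \<le> integral\<^sup>L \<Gamma> h * (1 / ?c)"
      by (intro mult_left_mono sum_power_le_inverse c h0)
    also have "\<dots> \<le> 64 * C0 * (1 + ln (1 / \<delta>')) * (1 / ?c)"
      using h(2) c by (intro mult_right_mono) auto
    finally show "(\<Sum>i<k. integral\<^sup>L \<Gamma> h * integral\<^sup>L \<Gamma> (u p \<delta>) ^ i) \<le> 64 * C0 * (1 + ln (1 / \<delta>')) / ?c"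
      by simp
  qed simp
  finally have le: "integral\<^sup>L (means k) bound \<le> real T * exp (- (real k * ?c')) + 4 * real T * \<delta>' + 64 * C0 * (1 + ln (1 / \<delta>')) / ?c" .
  show ?thesis unfolding bayes_regret_def
  proof (rule nonneg_bound_integral[OF _ bound_int le])
    show "AE \<mu> in means k. cond_regret P T k (seq_greedy k (2 * \<delta>)) \<mu> \<le> bound \<mu>"
      using AE_means
    proof eventually_elim
      case (elim \<mu>)
      have "(\<Sum>i<k. \<Prod>j<k. F i j (\<mu> j)) = (\<Sum>i<k. h (\<mu> i) * (\<Prod>j<i. u p \<delta> (\<mu> j)))"
        by (intro sum.cong refl) (simp add: F_prod)
      then show ?case
        using cond_regret_le[OF k _ \<delta>(1,2) p(2,4) surv surv', of \<mu> T] elim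
        unfolding bound_def h_def u_def by auto
    qed
    show "0 \<le> real T * exp (- (real k * ?c')) + 4 * real T * \<delta>' + 64 * C0 * (1 + ln (1 / \<delta>')) / ?c"
      using \<delta>'0 \<delta> C0_nonneg c0 p by (intro add_nonneg_nonneg divide_nonneg_nonneg mult_nonneg_nonneg) auto
  qed
qed

end

section \<open>Choosing the second threshold and counting logarithms\<close>

lemma Lg_ge_1: "1 \<le> T \<Longrightarrow> 1 \<le> Lg T k"
  by (simp add: Lg_def)

lemma ln_le_Lg: "1 \<le> T \<Longrightarrow> ln (real T) \<le> Lg T k"
proof -
  assume "1 \<le> T"
  then have "ln (real T) \<le> ln (real T + real k)" by (subst ln_le_cancel_iff) auto
  then show ?thesis by (simp add: Lg_def)
qed

context regular_prior
begin

text \<open>\<open>kf\<close> makes it likely, once \<delta>' carries enough logarithms, that some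
  good arm survives; \<open>Tf\<close> bounds 1 / f^(j+1), the exploration cost, by T f. Everything
  is then a polylogarithmic multiple of T f.\<close>

lemma seq_greedy_bound_of_survival:
  fixes f g :: "nat \<Rightarrow> nat \<Rightarrow> real" and j :: nat
  assumes f: "\<And>T k. 1 \<le> T \<Longrightarrow> 1 \<le> k \<Longrightarrow> 0 < f T k \<and> f T k \<le> 1"
    and kf: "\<And>T k. 1 \<le> T \<Longrightarrow> 1 \<le> k \<Longrightarrow> 1 \<le> real k * f T k ^ (j + 1)"
    and Tf: "\<And>T k. 1 \<le> T \<Longrightarrow> 1 \<le> k \<Longrightarrow> 1 \<le> real T * f T k ^ (j + 2)"
    and g: "\<And>T k. 1 \<le> T \<Longrightarrow> 1 \<le> k \<Longrightarrow> real T * f T k \<le> g T k"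
    and \<kappa>: "0 < \<kappa>" "\<kappa> \<le> 1" and r: "0 < r" "r \<le> 1"
    and surv: "\<And>d m. 0 < d \<Longrightarrow> d \<le> r \<Longrightarrow> 0 \<le> m \<Longrightarrow> m \<le> 1 \<Longrightarrow> 1 - d \<le> m \<Longrightarrow>
      \<kappa> * d ^ j / (1 + ln (1 / d)) \<le> survival_prob (P m) (1 - 2 * d)"
  shows "seq_greedy_bound P \<Gamma> f g"
  unfolding seq_greedy_bound_def
proof (intro allI impI)
  fix c :: real and a :: nat and \<delta> :: "nat \<Rightarrow> nat \<Rightarrow> real"
  assume "0 < c" and H: "\<forall>T k. 1 \<le> T \<longrightarrow> 1 \<le> k \<longrightarrow>
      f T k / (c * Lg T k ^ a) \<le> \<delta> T k \<and> \<delta> T k \<le> c * Lg T k ^ a * f T k"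
  define c1 where "c1 = max c 1"
  define C1 where "C1 = 2 + c1 + real a"
  \<comment> \<open>Chosen to dominate \<open>c1\<close> and also to satisfy C1 c1 \<le> c0 \<kappa>
    K; the latter makes the exponent of the first regret term at least \<open>L\<close>.\<close>
  define K where "K = c1 * (1 + C1 / (c0 * \<kappa>))"
  define D where "D = 64 * C0 * C1\<^sup>2 * c1 ^ (j + 1) / (c0 * \<kappa>)"
  \<comment> \<open>The sum of the two powers of the logarithm that occur below, hence above
    both.\<close>
  define b where "b = (2 * a + 2) + (a * (j + 1) + 2)"
  define C where "C = 1 + 4 * K * c1 + K * c1 / r + D"
  have c1: "1 \<le> c1" "c \<le> c1" by (auto simp: c1_def)
  have C1: "1 \<le> C1" using c1 by (simp add: C1_def)
  have c0\<kappa>: "0 < c0 * \<kappa>" using c0 \<kappa> by simp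
  have "c0 * \<kappa> * K = c0 * \<kappa> * c1 + C1 * c1"
    using c0 \<kappa> by (simp add: K_def field_simps)
  moreover have "K = c1 + c1 * (C1 / (c0 * \<kappa>))" by (simp add: K_def distrib_left)
  ultimately have K: "c1 \<le> K" "C1 * c1 \<le> c0 * \<kappa> * K"
    using c1 C1 c0\<kappa> by auto
  have K1: "1 \<le> K" using K c1 by simp
  have D: "0 \<le> D" using C0_nonneg c0\<kappa> c1 by (auto simp: D_def)
  show "\<exists>C b. \<forall>T k. 1 \<le> T \<longrightarrow> 1 \<le> k \<longrightarrow>
      bayes_regret P \<Gamma> T k (seq_greedy k (2 * \<delta> T k)) \<le> C * Lg T k ^ b * g T k"
  proof (rule exI[of _ C], rule exI[of _ b], intro allI impI)
    fix T k :: nat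
    assume T: "1 \<le> T" and k: "1 \<le> k"
    define L where "L = Lg T k"
    define F where "F = f T k"
    define d where "d = \<delta> T k"
    \<comment> \<open>L^a undoes the possible loss of \<delta> against \<open>f\<close>. Of the two
      extra logarithms, one pays for the denominator of the survival bound and one for ln T.\<close>
    define d' where "d' = K * L ^ (a + 2) * d"
    have L: "1 \<le> L" and lnT: "ln (real T) \<le> L"
      unfolding L_def using Lg_ge_1 ln_le_Lg T by auto
    have La: "1 \<le> L ^ n" for n using L by (rule one_le_power)
    have F: "0 < F" "F \<le> 1" "1 \<le> real k * F ^ (j + 1)" "1 \<le> real T * F ^ (j + 2)" "real T * F \<le> g T k"
      unfolding F_def using f[OF T k] kf[OF T k] Tf[OF T k] g[OF T k] by auto
    have "F / (c1 * L ^ a) \<le> F / (c * L ^ a)"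
      using \<open>0 < c\<close> c1 F L by (intro divide_left_mono mult_right_mono mult_pos_pos) auto
    also have "\<dots> \<le> d" using H T k by (simp add: F_def L_def d_def)
    finally have dlow: "F / (c1 * L ^ a) \<le> d" .
    have "d \<le> c * L ^ a * F" using H T k by (simp add: F_def L_def d_def)
    also have "\<dots> \<le> c1 * L ^ a * F" using c1 F L by (intro mult_right_mono) auto
    finally have dup: "d \<le> c1 * L ^ a * F" .
    have "0 < F / (c1 * L ^ a)" using F c1 L by simp
    then have d0: "0 < d" using dlow by linarith
    have inv_d: "1 / d \<le> c1 * L ^ a / F"
      using dlow d0 F c1 L by (simp add: field_simps)
    have "1 * 1 \<le> K * L ^ (a + 2)" using mult_mono[OF K1 La[of "a + 2"]] K1 by simp
    from mult_right_mono[OF this, of d] have dd': "d \<le> d'" using d0 by (simp add: d'_def)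
    have d'up: "d' \<le> K * c1 * L ^ (2 * a + 2) * F"
    proof -
      have "d' \<le> K * L ^ (a + 2) * (c1 * L ^ a * F)"
        unfolding d'_def using dup K1 L by (intro mult_left_mono) auto
      also have "\<dots> = K * c1 * L ^ (2 * a + 2) * F" by (simp add: power_add mult_2)
      finally show ?thesis .
    qed
    have TF: "1 \<le> real T * F"
    proof -
      have "F ^ (j + 2) \<le> F ^ 1" using F by (intro power_decreasing) auto
      then have "real T * F ^ (j + 2) \<le> real T * F" by (intro mult_left_mono) auto
      then show ?thesis using F(4) by linarith
    qed
    have final: "x * L ^ n * (real T * F) \<le> x * L ^ b * (real T * F)" if "0 \<le> x" "n \<le> b" for x n
      using that TF L by (intro mult_right_mono mult_left_mono power_increasing) auto
    have goal: "bayes_regret P \<Gamma> T k (seq_greedy k (2 * d)) \<le> C * L ^ b * (real T * F)"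
    \<comment> \<open>When \<open>d'\<close> exceeds \<open>r\<close> there is no survival bound at
      \<open>d'\<close>, but then the trivial regret T is at most T d' / r, already of the right
      order.\<close>
    proof (cases "d' \<le> r")
      case False
      have "bayes_regret P \<Gamma> T k (seq_greedy k (2 * d)) \<le> real T"
        using bayes_regret_le_trivial k by simp
      also have "\<dots> \<le> real T * (d' / r)"
        using False r mult_left_mono[of 1 "d' / r" "real T"] by simp
      also have "\<dots> \<le> real T * (K * c1 * L ^ (2 * a + 2) * F / r)"
        using d'up r by (intro mult_left_mono divide_right_mono) auto
      also have "\<dots> = K * c1 / r * L ^ (2 * a + 2) * (real T * F)" by simp
      also have "\<dots> \<le> K * c1 / r * L ^ b * (real T * F)"
        using K1 c1 r by (intro final) (auto simp: b_def)
      also have "\<dots> \<le> C * L ^ b * (real T * F)"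
        using TF L D K1 c1 by (intro mult_right_mono) (auto simp: C_def)
      finally show ?thesis .
    next
      case True
      have d1: "d' \<le> 1" "d \<le> 1" "0 < d'" using True r dd' d0 by auto
      define lg where "lg x = 1 + ln (1 / x)" for x :: real
      have lgd': "1 \<le> lg d'" "lg d' \<le> lg d"
        using d1 d0 dd' by (auto simp: lg_def ln_le_cancel_iff frac_le)
      have "lg d \<le> C1 * L"
      proof -
        have "ln (1 / d) \<le> ln (c1 * L ^ a / F)"
          using inv_d d0 F c1 L by (subst ln_le_cancel_iff) auto
        also have "\<dots> = ln c1 + real a * ln L + ln (1 / F)"
          using c1 L F by (simp add: ln_mult ln_div ln_realpow)
        also have "\<dots> \<le> c1 + real a * L + L"
        proof (intro add_mono mult_left_mono)
          show "ln c1 \<le> c1" "ln L \<le> L" using c1 L ln_bound by auto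
          have "1 / F \<le> real T" using TF F by (simp add: field_simps)
          then have "ln (1 / F) \<le> ln (real T)" using F T by (subst ln_le_cancel_iff) auto
          then show "ln (1 / F) \<le> L" using lnT by linarith
        qed simp
        finally have "lg d \<le> 1 + c1 + real a * L + L" by (simp add: lg_def)
        also have "\<dots> \<le> L + c1 * L + real a * L + L"
        proof -
          have "c1 * 1 \<le> c1 * L" using L c1 by (intro mult_left_mono) auto
          then show ?thesis using L by linarith
        qed
        also have "\<dots> = C1 * L" by (simp add: C1_def algebra_simps)
        finally show ?thesis .
      qed
      then have lg: "0 < lg d" "lg d \<le> C1 * L" "0 < lg d'" "lg d' \<le> C1 * L"
        using lgd' by auto
      define p where "p x = \<kappa> * x ^ j / lg x" for x
      have p_bounds: "0 < p x" "p x \<le> 1" "c0 * \<kappa> * x ^ (j + 1) / (C1 * L) \<le> c0 * p x * x"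
        if "0 < x" "x \<le> 1" "1 \<le> lg x" "lg x \<le> C1 * L" for x
      proof -
        show "0 < p x" using that \<kappa> by (simp add: p_def)
        have "\<kappa> * x ^ j \<le> 1 * 1" using that \<kappa> by (intro mult_mono power_le_one) auto
        then show "p x \<le> 1" using that by (simp add: p_def)
        have "c0 * \<kappa> * x ^ (j + 1) / (C1 * L) \<le> c0 * \<kappa> * x ^ (j + 1) / lg x"
          using that c0 \<kappa> by (intro divide_left_mono mult_nonneg_nonneg) auto
        then show "c0 * \<kappa> * x ^ (j + 1) / (C1 * L) \<le> c0 * p x * x"
          by (simp add: p_def mult_ac)
      qed
      note pd = p_bounds[OF d0 d1(2) order_trans[OF lgd'] lg(2)]
      note pd' = p_bounds[OF d1(3,1) lgd'(1) lg(4)]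
      have bound: "bayes_regret P \<Gamma> T k (seq_greedy k (2 * d)) \<le>
          real T * exp (- (real k * (c0 * p d' * d'))) + 4 * real T * d' + 64 * C0 * lg d' / (c0 * p d * d)"
        unfolding lg_def
      proof (rule bayes_regret_le[OF _ d0 dd' d1(1) pd(1,2) pd'(1,2)])
        show "p d \<le> survival_prob (P m) (1 - 2 * d)" if "0 \<le> m" "m \<le> 1" "1 - d \<le> m" for m
          using surv[of d m] that d0 dd' True by (simp add: p_def lg_def)
        show "p d' \<le> survival_prob (P m) (1 - 2 * d')" if "0 \<le> m" "m \<le> 1" "1 - d' \<le> m" for m
          using surv[of d' m] that d1 True by (simp add: p_def lg_def)
      qed (use k in simp)
      have first: "real T * exp (- (real k * (c0 * p d' * d'))) \<le> real T * F"
      proof -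
        have d'low: "(K / c1 * L\<^sup>2) * F \<le> d'"
        proof -
          have "(K / c1 * L\<^sup>2) * F = K * L ^ (a + 2) * (F / (c1 * L ^ a))"
            using L c1 by (simp add: power_add power2_eq_square)
          also have "\<dots> \<le> d'" unfolding d'_def using dlow K1 L by (intro mult_left_mono) auto
          finally show ?thesis .
        qed
        have Kc: "1 \<le> K / c1" using K c1 by simp
        have y: "1 \<le> K / c1 * L\<^sup>2"
          using mult_mono[OF Kc La[of 2]] Kc by simp
        \<comment> \<open>Only one factor of the coefficient is kept; since it is at least 1, this
          underestimates its (j+1)-st power.\<close>
        have "(K / c1 * L\<^sup>2) * F ^ (j + 1) \<le> (K / c1 * L\<^sup>2) ^ (j + 1) * F ^ (j + 1)"
          by (intro mult_right_mono self_le_power y) (use F in auto)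
        also have "\<dots> = ((K / c1 * L\<^sup>2) * F) ^ (j + 1)" by (rule power_mult_distrib[symmetric])
        also have "\<dots> \<le> d' ^ (j + 1)" using K1 c1 F by (intro power_mono d'low) auto
        finally have pw: "(K / c1 * L\<^sup>2) * F ^ (j + 1) \<le> d' ^ (j + 1)" .
        have X: "1 \<le> c0 * \<kappa> * K / (c1 * C1)"
          using K(2) c1 C1 by (simp add: mult_ac)
        have "1 * 1 \<le> c0 * \<kappa> * K / (c1 * C1) * (real k * F ^ (j + 1))"
          by (intro mult_mono X F(3)) (use X in auto)
        then have "L * (1 * 1) \<le> L * (c0 * \<kappa> * K / (c1 * C1) * (real k * F ^ (j + 1)))"
          using L by (intro mult_left_mono) auto
        also have "\<dots> = real k * (c0 * \<kappa> * ((K / c1 * L\<^sup>2) * F ^ (j + 1)) / (C1 * L))"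
          using L c1 C1 by (simp add: field_simps power2_eq_square)
        also have "\<dots> \<le> real k * (c0 * \<kappa> * d' ^ (j + 1) / (C1 * L))"
          using pw c0 \<kappa> C1 L by (intro mult_left_mono divide_right_mono) auto
        also have "\<dots> \<le> real k * (c0 * p d' * d')"
          using pd'(3) by (intro mult_left_mono) auto
        finally have "ln (real T) \<le> real k * (c0 * p d' * d')" using lnT by simp
        then have "exp (- (real k * (c0 * p d' * d'))) \<le> exp (- ln (real T))" by simp
        also have "\<dots> = 1 / real T" using T by (simp add: exp_minus inverse_eq_divide)
        finally have "real T * exp (- (real k * (c0 * p d' * d'))) \<le> real T * (1 / real T)"
          by (intro mult_left_mono) auto
        moreover have "real T * (1 / real T) = 1" using T by simp
        ultimately show ?thesis using TF by linarith
      qed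
      have third: "64 * C0 * lg d' / (c0 * p d * d) \<le> D * L ^ (a * (j + 1) + 2) * (real T * F)"
      proof -
        \<comment> \<open>A restatement of \<open>Tf\<close>.\<close>
        have "1 / F ^ (j + 1) \<le> real T * F"
          using F(1,4) by (simp add: field_simps)
        moreover have "(1 / d) ^ (j + 1) \<le> (c1 * L ^ a / F) ^ (j + 1)"
          using inv_d d0 by (intro power_mono) auto
        moreover have "(c1 * L ^ a / F) ^ (j + 1) = c1 ^ (j + 1) * L ^ (a * (j + 1)) * (1 / F ^ (j + 1))"
          by (simp only: power_divide power_mult_distrib power_mult) simp
        moreover have "c1 ^ (j + 1) * L ^ (a * (j + 1)) * (1 / F ^ (j + 1)) \<le> c1 ^ (j + 1) * L ^ (a * (j + 1)) * (real T * F)"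
          using calculation(1) c1 L by (intro mult_left_mono) auto
        ultimately have inv: "(1 / d) ^ (j + 1) \<le> c1 ^ (j + 1) * L ^ (a * (j + 1)) * (real T * F)"
          by linarith
        have "64 * C0 * lg d' / (c0 * p d * d) \<le> 64 * C0 * (C1 * L) / (c0 * \<kappa> * d ^ (j + 1) / (C1 * L))"
          using lg pd(3) C0_nonneg c0 \<kappa> d0 C1 L by (intro frac_le mult_left_mono mult_nonneg_nonneg) auto
        also have "\<dots> = 64 * C0 * C1\<^sup>2 * L\<^sup>2 / (c0 * \<kappa>) * (1 / d) ^ (j + 1)"
          using C1 L by (simp add: power2_eq_square power_divide)
        also have "\<dots> \<le> 64 * C0 * C1\<^sup>2 * L\<^sup>2 / (c0 * \<kappa>) * (c1 ^ (j + 1) * L ^ (a * (j + 1)) * (real T * F))"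
          using C0_nonneg c0 \<kappa> by (intro mult_left_mono inv) auto
        also have "\<dots> = D * L ^ (a * (j + 1) + 2) * (real T * F)"
          by (simp add: D_def power_add power2_eq_square)
        finally show ?thesis .
      qed
      have second: "4 * real T * d' \<le> 4 * K * c1 * L ^ (2 * a + 2) * (real T * F)"
        using mult_left_mono[OF d'up, of "4 * real T"] by (simp add: mult_ac)
      have "bayes_regret P \<Gamma> T k (seq_greedy k (2 * d)) \<le>
          1 * L ^ 0 * (real T * F) + 4 * K * c1 * L ^ (2 * a + 2) * (real T * F) + D * L ^ (a * (j + 1) + 2) * (real T * F)"
        using bound first second third by simp
      also have "\<dots> \<le> 1 * L ^ b * (real T * F) + 4 * K * c1 * L ^ b * (real T * F) + D * L ^ b * (real T * F)"
        using K1 c1 D by (intro add_mono final) (auto simp: b_def)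
      also have "\<dots> = (1 + 4 * K * c1 + D) * L ^ b * (real T * F)" by (simp add: algebra_simps)
      also have "\<dots> \<le> C * L ^ b * (real T * F)"
        using TF L K1 c1 r by (intro mult_right_mono) (auto simp: C_def)
      finally show ?thesis .
    qed
    also have "\<dots> \<le> C * L ^ b * g T k"
      using F(5) L K1 c1 r D by (intro mult_left_mono) (auto simp: C_def)
    finally show "bayes_regret P \<Gamma> T k (seq_greedy k (2 * \<delta> T k)) \<le> C * Lg T k ^ b * g T k"
      unfolding d_def L_def .
  qed
qed

end

section \<open>Bernoulli and subgaussian rewards\<close>

context real_walk
begin

lemma survival_prob_nonneg: "0 \<le> survival_prob Q \<theta>"
  by (simp add: survival_prob_def)

text \<open>The drift over 1 - 2d is at least d. An exponential moment makes the excess of the first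
  step over a logarithmic level at most d/2, so the other half of the drift must come from
  survival.\<close>

lemma survival_ge_subgaussian:
  assumes int: "integrable Q (\<lambda>x. x)" and mean: "(\<integral>x. x \<partial>Q) = m"
    and exp_int: "integrable Q (\<lambda>x. exp (x - m))" and exp_le: "(\<integral>x. exp (x - m) \<partial>Q) \<le> exp (1 / 2)"
    and d: "0 < d" "d \<le> 1" "1 - d \<le> m" "m \<le> 1"
  shows "1 / 8 * d / (1 + ln (1 / d)) \<le> survival_prob Q (1 - 2 * d)"
proof -
  let ?\<theta> = "1 - 2 * d" and ?q = "survival_prob Q (1 - 2 * d)"
  define l where "l = ln (1 / d)"
  \<comment> \<open>The exponent of the excess is at most 2d + 1/2 - B. As d \<le> 1, the 5/2
    absorbs the first two terms and the logarithm leaves exactly d/2.\<close>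
  define B where "B = 5 / 2 + ln (2 / d)"
  have l: "0 \<le> l" using d by (simp add: l_def)
  have "ln (2 / d) = ln 2 + l" using d by (simp add: l_def ln_div)
  then have B: "0 \<le> B" "B \<le> 4 * (1 + l)" using l ln_2_less_1 by (auto simp: B_def)
  have "(\<integral>x. max 0 (x - ?\<theta> - B) \<partial>Q) \<le> (\<integral>x. exp (m - ?\<theta> - B) * exp (x - m) \<partial>Q)"
  proof (rule integral_mono)
    show "integrable Q (\<lambda>x. max 0 (x - ?\<theta> - B))" using int by (intro integrable_max) auto
    show "integrable Q (\<lambda>x. exp (m - ?\<theta> - B) * exp (x - m))" using exp_int by simp
    show "max 0 (x - ?\<theta> - B) \<le> exp (m - ?\<theta> - B) * exp (x - m)" for x
    proof -
      have "x - ?\<theta> - B \<le> exp (x - ?\<theta> - B)"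
        using exp_ge_add_one_self[of "x - ?\<theta> - B"] by linarith
      then have "max 0 (x - ?\<theta> - B) \<le> exp (x - ?\<theta> - B)" by simp
      also have "\<dots> = exp (m - ?\<theta> - B) * exp (x - m)" by (subst exp_add[symmetric]) simp
      finally show ?thesis .
    qed
  qed
  also have "\<dots> = exp (m - ?\<theta> - B) * (\<integral>x. exp (x - m) \<partial>Q)" by simp
  also have "\<dots> \<le> exp (m - ?\<theta> - B) * exp (1 / 2)" by (intro mult_left_mono exp_le) simp
  also have "\<dots> = exp (m - ?\<theta> - B + 1 / 2)" by (simp only: exp_add)
  also have "\<dots> \<le> exp (- ln (2 / d))" using d by (simp add: B_def)
  also have "\<dots> = d / 2" using d by (simp add: exp_minus)
  finally have "d \<le> B * ?q + d / 2"
    using drift_le_survival[OF int B(1), of ?\<theta>] mean d by simp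
  also have "B * ?q \<le> 4 * (1 + l) * ?q" by (intro mult_right_mono B survival_prob_nonneg)
  finally have "d \<le> 8 * (1 + l) * ?q" by (simp add: algebra_simps)
  then show ?thesis unfolding l_def[symmetric] using l by (simp add: pos_divide_le_eq mult_ac)
qed

end

section \<open>Bernoulli rewards\<close>

lemma prob_space_bernoulli_family: "prob_space (bernoulli_family m)"
  unfolding bernoulli_family_def by (intro measure_pmf.prob_space_distr) simp

lemma sets_bernoulli_family [simp]: "sets (bernoulli_family m) = sets borel"
  by (simp add: bernoulli_family_def)

lemma AE_bernoulli_family: "AE x in bernoulli_family m. x \<in> {0..1}"
  unfolding bernoulli_family_def by (subst AE_distr_iff) auto

lemma integral_bernoulli_family:
  fixes h :: "real \<Rightarrow> real"
  assumes "0 \<le> m" "m \<le> 1" "h \<in> borel_measurable borel"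
  shows "integrable (bernoulli_family m) h" "(\<integral>x. h x \<partial>bernoulli_family m) = m * h 1 + (1 - m) * h 0"
proof -
  show "integrable (bernoulli_family m) h"
    unfolding bernoulli_family_def using assms
    by (subst integrable_distr_eq) (auto intro!: integrable_measure_pmf_finite)
  show "(\<integral>x. h x \<partial>bernoulli_family m) = m * h 1 + (1 - m) * h 0"
    unfolding bernoulli_family_def using assms by (subst integral_distr) auto
qed

text \<open>Hoeffding's lemma for a two-point law gives variance factor 1/4, stronger than the
  required 1.\<close>

lemma bernoulli_mgf:
  assumes m: "0 \<le> m" "m \<le> 1" and s: "0 < s"
  shows "(\<integral>\<^sup>+x. ennreal (exp (s * (x - m))) \<partial>bernoulli_family m) \<le> ennreal (exp (s\<^sup>2 / 2))"
proof -
  note I = integral_bernoulli_family[OF m, of "\<lambda>x. exp (s * (x - m))"]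
  have pos: "0 < 1 + m * (exp s - 1)" using m s by (intro add_pos_nonneg mult_nonneg_nonneg) auto
  have "(\<integral>x. exp (s * (x - m)) \<partial>bernoulli_family m) = exp (- s * m) * (1 + m * (exp s - 1))"
    using I by (simp add: algebra_simps exp_diff exp_minus divide_simps)
  also have "\<dots> = exp (- s * m + ln (1 + m * (exp s - 1)))"
    by (subst exp_add) (simp add: pos)
  also have "\<dots> \<le> exp (s\<^sup>2 / 8)" using Hoeffdings_lemma_aux[of s m] m s by simp
  also have "\<dots> \<le> exp (s\<^sup>2 / 2)" by simp
  finally have "(\<integral>x. exp (s * (x - m)) \<partial>bernoulli_family m) \<le> exp (s\<^sup>2 / 2)" .
  then show ?thesis using I(1) by (subst nn_integral_eq_integral) (auto intro: ennreal_leI)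
qed

text \<open>The first step is at most 2d, since rewards do not exceed 1. Cutting at 2d leaves no
  excess, and drift at least d against a step of at most 2d gives 1/2 with no dependence on
  d.\<close>

lemma bernoulli_survival:
  assumes d: "0 < d" "1 - d \<le> m" "0 \<le> m" "m \<le> 1"
  shows "1 / 2 \<le> survival_prob (bernoulli_family m) (1 - 2 * d)"
proof -
  have I: "integrable (bernoulli_family m) (\<lambda>x. x)" "(\<integral>x. x \<partial>bernoulli_family m) = m"
  proof -
    have id: "(\<lambda>x. x) \<in> borel_measurable borel" by simp
    note integral_bernoulli_family[OF d(3,4) id]
    then show "integrable (bernoulli_family m) (\<lambda>x. x)" "(\<integral>x. x \<partial>bernoulli_family m) = m" by auto
  qed
  interpret real_walk "bernoulli_family m"
    by (rule real_walkI[OF prob_space_bernoulli_family sets_bernoulli_family])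
  have "AE x in bernoulli_family m. max 0 (x - (1 - 2 * d) - 2 * d) = 0"
    using AE_bernoulli_family[of m] by eventually_elim auto
  then have excess: "(\<integral>x. max 0 (x - (1 - 2 * d) - 2 * d) \<partial>bernoulli_family m) = 0"
    by (rule integral_eq_zero_AE)
  have "0 \<le> 2 * d" using d by simp
  from drift_le_survival[OF I(1) this, of "1 - 2 * d"]
  have "m - (1 - 2 * d) \<le> 2 * d * survival_prob (bernoulli_family m) (1 - 2 * d)"
    unfolding I(2) excess by linarith
  then have "d * 1 \<le> d * (2 * survival_prob (bernoulli_family m) (1 - 2 * d))"
    using d by linarith
  then show ?thesis using d by (simp only: mult_le_cancel_left_pos)
qed

section \<open>From the assumptions on prior and rewards to the three regimes\<close>

lemma regular_priorI:
  assumes "reward_kernel P" "prior_dist \<Gamma>" "one_regular \<Gamma>"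
  obtains c0 C0 where "regular_prior P \<Gamma> c0 C0"
proof -
  obtain c0 C0 where c0: "0 < c0" and reg: "\<And>\<epsilon>. 0 < \<epsilon> \<Longrightarrow> \<epsilon> \<le> 1 \<Longrightarrow>
        c0 * \<epsilon> \<le> measure \<Gamma> {1 - \<epsilon><..} \<and>
        measure \<Gamma> {1 - \<epsilon><..} \<le> measure \<Gamma> {1 - \<epsilon>..} \<and>
        measure \<Gamma> {1 - \<epsilon>..} \<le> C0 * \<epsilon>"
    using assms(3) unfolding one_regular_def by blast
  have "regular_prior P \<Gamma> c0 C0"
  proof (intro regular_prior.intro assms(1) regular_prior_axioms.intro)
    show "prob_space \<Gamma>" "sets \<Gamma> = sets borel" "measure \<Gamma> {0..1} = 1"
      using assms(2) by (auto simp: prior_dist_def)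
    show "c0 * \<epsilon> \<le> measure \<Gamma> {1 - \<epsilon>..}" "measure \<Gamma> {1 - \<epsilon>..} \<le> C0 * \<epsilon>" if "0 < \<epsilon>" "\<epsilon> \<le> 1" for \<epsilon>
      using reg[OF that] by auto
  qed (rule c0)
  then show thesis by (rule that)
qed

lemma reward_kernel_subgaussian:
  assumes "reward_family P" "\<forall>\<mu>\<in>{0..1}. subgaussian1 (P \<mu>) \<mu>"
  shows "reward_kernel P"
proof (rule reward_kernel.intro)
  fix m s :: real assume m: "0 \<le> m" "m \<le> 1"
  then show "prob_space (P m)" "sets (P m) = sets borel"
    using assms(1) by (auto simp: reward_family_def)
  have "integrable (P m) (\<lambda>x. exp (s * (x - m)))" "(\<integral>x. exp (s * (x - m)) \<partial>P m) \<le> exp (s\<^sup>2 / 2)"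
    using assms(2) m by (auto simp: subgaussian1_def)
  then show "(\<integral>\<^sup>+x. ennreal (exp (s * (x - m))) \<partial>P m) \<le> ennreal (exp (s\<^sup>2 / 2))"
    by (subst nn_integral_eq_integral) (auto intro: ennreal_leI)
qed

lemma subgaussian_survival:
  assumes P: "reward_family P" "\<forall>\<mu>\<in>{0..1}. subgaussian1 (P \<mu>) \<mu>"
    and d: "0 < d" "d \<le> 1" "0 \<le> m" "m \<le> 1" "1 - d \<le> m"
  shows "1 / 8 * d / (1 + ln (1 / d)) \<le> survival_prob (P m) (1 - 2 * d)"
proof -
  have fam: "prob_space (P m)" "sets (P m) = sets borel" "integrable (P m) (\<lambda>x. x)" "(\<integral>x. x \<partial>P m) = m"
    using P(1) d by (auto simp: reward_family_def)
  have "subgaussian1 (P m) m" using P(2) d by auto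
  from this[unfolded subgaussian1_def, rule_format, of 1] show ?thesis
    using real_walk.survival_ge_subgaussian[OF real_walkI[OF fam(1,2)] fam(3,4) _ _ d(1,2,5,4)] by simp
qed

lemma powr_neg_power:
  fixes x :: real
  assumes "0 < x" "0 < n"
  shows "(x powr (- 1 / real n)) ^ n = 1 / x"
proof -
  have "(x powr (- 1 / real n)) ^ n = x powr (- 1 / real n * real n)"
    using assms by (subst powr_realpow[symmetric]) (auto simp: powr_powr)
  also have "\<dots> = 1 / x" using assms powr_minus_divide[of x 1] by simp
  finally show ?thesis .
qed

lemma powr_neg_le_1:
  fixes x a :: real
  assumes "1 \<le> x" "0 < a"
  shows "x powr (- a) \<le> 1"
  using assms powr_mono[of "- a" 0 x] by simp

theorem theorem7:
  fixes \<Gamma> :: "real measure"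
  assumes "prior_dist \<Gamma>" and "one_regular \<Gamma>"
  shows
    "seq_greedy_bound bernoulli_family \<Gamma>
        (\<lambda>T k. max (1 / real k) (1 / sqrt (real T)))
        (\<lambda>T k. max (sqrt (real T)) (real T / real k))
   \<and> (\<forall>P. reward_family P \<and> (\<forall>\<mu>\<in>{0..1}. subgaussian1 (P \<mu>) \<mu>) \<longrightarrow>
        seq_greedy_bound P \<Gamma>
          (\<lambda>T k. max (real k powr (-1/3)) (real T powr (-1/4)))
          (\<lambda>T k. max (real T powr (3/4)) (real T / real k powr (1/3))))
   \<and> (\<forall>P p0 \<delta>0. reward_family P \<and> (\<forall>\<mu>\<in>{0..1}. subgaussian1 (P \<mu>) \<mu>) \<and>
               unif_upward_looking P p0 \<delta>0 \<longrightarrow>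
        seq_greedy_bound P \<Gamma>
          (\<lambda>T k. max (real k powr (-1/2)) (real T powr (-1/3)))
          (\<lambda>T k. max (real T powr (2/3)) (real T / sqrt (real k))))"
proof (intro conjI allI impI)
  \<comment> \<open>Each balance condition is met with equality by one of the two entries of the
    maximum, and the maximum only helps.\<close>
  have scale: "1 \<le> real n * max x y ^ i" if "real n * z ^ i = 1" "0 \<le> z" "z \<le> max x y" for n i and x y z :: real
  proof -
    have "z ^ i \<le> max x y ^ i" using that by (intro power_mono) auto
    then have "real n * z ^ i \<le> real n * max x y ^ i" by (intro mult_left_mono) auto
    then show ?thesis using that by simp
  qed
  have root: "real n * (real n powr (- 1 / real i)) ^ i = 1" if "1 \<le> n" "0 < i" for n i
    using that powr_neg_power[of "real n" i] by simp
  have mult_max: "real n * max x y \<le> max b a" if "real n * x = a" "real n * y = b" for n and x y a b :: real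
    using that by (auto simp: max_def)
  {
    have "reward_kernel bernoulli_family"
      by (rule reward_kernel.intro) (auto intro: prob_space_bernoulli_family bernoulli_mgf)
    then obtain c0 C0 where "regular_prior bernoulli_family \<Gamma> c0 C0"
      using assms by (rule regular_priorI)
    then interpret regular_prior bernoulli_family \<Gamma> c0 C0 .
    show "seq_greedy_bound bernoulli_family \<Gamma>
        (\<lambda>T k. max (1 / real k) (1 / sqrt (real T))) (\<lambda>T k. max (sqrt (real T)) (real T / real k))"
    proof (rule seq_greedy_bound_of_survival[where j = 0 and \<kappa> = "1 / 2" and r = 1])
      fix T k :: nat assume T: "1 \<le> T" and k: "1 \<le> k"
      show "0 < max (1 / real k) (1 / sqrt (real T)) \<and> max (1 / real k) (1 / sqrt (real T)) \<le> 1"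
        using T k by (auto simp: less_max_iff_disj)
      show "1 \<le> real k * max (1 / real k) (1 / sqrt (real T)) ^ (0 + 1)"
        using k by (intro scale[where z = "1 / real k"]) auto
      show "1 \<le> real T * max (1 / real k) (1 / sqrt (real T)) ^ (0 + 2)"
        using T by (intro scale[where z = "1 / sqrt (real T)"]) (auto simp: power_divide)
      show "real T * max (1 / real k) (1 / sqrt (real T)) \<le> max (sqrt (real T)) (real T / real k)"
        using T by (intro mult_max) (auto simp: real_div_sqrt)
    next
      fix d m :: real assume d: "0 < d" "d \<le> 1" "0 \<le> m" "m \<le> 1" "1 - d \<le> m"
      have "1 \<le> 1 + ln (1 / d)" using d by simp
      then have "1 / 2 * d ^ 0 / (1 + ln (1 / d)) \<le> 1 / 2" by (simp add: divide_simps)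
      also have "\<dots> \<le> survival_prob (bernoulli_family m) (1 - 2 * d)" using d by (intro bernoulli_survival)
      finally show "1 / 2 * d ^ 0 / (1 + ln (1 / d)) \<le> survival_prob (bernoulli_family m) (1 - 2 * d)" .
    qed auto
  }
  {
    fix P assume "reward_family P \<and> (\<forall>\<mu>\<in>{0..1}. subgaussian1 (P \<mu>) \<mu>)"
    then have P: "reward_family P" "\<forall>\<mu>\<in>{0..1}. subgaussian1 (P \<mu>) \<mu>" by auto
    obtain c0 C0 where "regular_prior P \<Gamma> c0 C0"
      using reward_kernel_subgaussian[OF P] assms by (rule regular_priorI)
    then interpret regular_prior P \<Gamma> c0 C0 .
    show "seq_greedy_bound P \<Gamma> (\<lambda>T k. max (real k powr (-1/3)) (real T powr (-1/4)))
          (\<lambda>T k. max (real T powr (3/4)) (real T / real k powr (1/3)))"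
    proof (rule seq_greedy_bound_of_survival[where j = 2 and \<kappa> = "1 / 8" and r = 1])
      fix T k :: nat assume T: "1 \<le> T" and k: "1 \<le> k"
      show "0 < max (real k powr (-1/3)) (real T powr (-1/4)) \<and> max (real k powr (-1/3)) (real T powr (-1/4)) \<le> 1"
        using T k powr_neg_le_1[of "real k" "1/3"] powr_neg_le_1[of "real T" "1/4"] by (auto simp: less_max_iff_disj)
      show "1 \<le> real k * max (real k powr (-1/3)) (real T powr (-1/4)) ^ (2 + 1)"
        using root[OF k, of 3] by (intro scale[where z = "real k powr (-1/3)"]) auto
      show "1 \<le> real T * max (real k powr (-1/3)) (real T powr (-1/4)) ^ (2 + 2)"
        using root[OF T, of 4] by (intro scale[where z = "real T powr (-1/4)"]) auto
      show "real T * max (real k powr (-1/3)) (real T powr (-1/4)) \<le> max (real T powr (3/4)) (real T / real k powr (1/3))"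
      proof (rule mult_max)
        show "real T * real k powr (-1/3) = real T / real k powr (1/3)"
          using powr_minus_divide[of "real k" "1/3"] by simp
        show "real T * real T powr (-1/4) = real T powr (3/4)"
          using T powr_add[of "real T" 1 "-1/4"] by simp
      qed
    next
      fix d m :: real assume d: "0 < d" "d \<le> 1" "0 \<le> m" "m \<le> 1" "1 - d \<le> m"
      \<comment> \<open>Survival of order d is weakened to d^2, so that the powers j + 1 = 3 and j +
        2 = 4 match k^(-1/3) and T^(-1/4).\<close>
      have "d ^ 2 \<le> d ^ 1" using d by (intro power_decreasing) auto
      moreover have "0 \<le> ln (1 / d)" using d by simp
      ultimately have "1 / 8 * d ^ 2 / (1 + ln (1 / d)) \<le> 1 / 8 * d / (1 + ln (1 / d))"
        by (intro divide_right_mono mult_left_mono) auto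
      also have "\<dots> \<le> survival_prob (P m) (1 - 2 * d)" by (rule subgaussian_survival[OF P d])
      finally show "1 / 8 * d ^ 2 / (1 + ln (1 / d)) \<le> survival_prob (P m) (1 - 2 * d)" .
    qed auto
  }
  {
    fix P p0 \<delta>0
    assume "reward_family P \<and> (\<forall>\<mu>\<in>{0..1}. subgaussian1 (P \<mu>) \<mu>) \<and> unif_upward_looking P p0 \<delta>0"
    then have P: "reward_family P" "\<forall>\<mu>\<in>{0..1}. subgaussian1 (P \<mu>) \<mu>" by auto
    obtain c0 C0 where "regular_prior P \<Gamma> c0 C0"
      using reward_kernel_subgaussian[OF P] assms by (rule regular_priorI)
    then interpret regular_prior P \<Gamma> c0 C0 .
    show "seq_greedy_bound P \<Gamma> (\<lambda>T k. max (real k powr (-1/2)) (real T powr (-1/3)))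
          (\<lambda>T k. max (real T powr (2/3)) (real T / sqrt (real k)))"
    \<comment> \<open>Survival linear in d up to the logarithm: the powers 2 and 3 match k^(-1/2)
      and T^(-1/3).\<close>
    proof (rule seq_greedy_bound_of_survival[where j = 1 and \<kappa> = "1 / 8" and r = 1])
      fix T k :: nat assume T: "1 \<le> T" and k: "1 \<le> k"
      show "0 < max (real k powr (-1/2)) (real T powr (-1/3)) \<and> max (real k powr (-1/2)) (real T powr (-1/3)) \<le> 1"
        using T k powr_neg_le_1[of "real k" "1/2"] powr_neg_le_1[of "real T" "1/3"] by (auto simp: less_max_iff_disj)
      show "1 \<le> real k * max (real k powr (-1/2)) (real T powr (-1/3)) ^ (1 + 1)"
        using root[OF k, of 2] by (intro scale[where z = "real k powr (-1/2)"]) (auto simp: power2_eq_square)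
      show "1 \<le> real T * max (real k powr (-1/2)) (real T powr (-1/3)) ^ (1 + 2)"
        using root[OF T, of 3] by (intro scale[where z = "real T powr (-1/3)"]) (auto simp: power3_eq_cube)
      show "real T * max (real k powr (-1/2)) (real T powr (-1/3)) \<le> max (real T powr (2/3)) (real T / sqrt (real k))"
      proof (rule mult_max)
        show "real T * real k powr (-1/2) = real T / sqrt (real k)"
          using powr_minus_divide[of "real k" "1/2"] by (simp add: powr_half_sqrt)
        show "real T * real T powr (-1/3) = real T powr (2/3)"
          using T powr_add[of "real T" 1 "-1/3"] by simp
      qed
    next
      fix d m :: real assume d: "0 < d" "d \<le> 1" "0 \<le> m" "m \<le> 1" "1 - d \<le> m"
      show "1 / 8 * d ^ 1 / (1 + ln (1 / d)) \<le> survival_prob (P m) (1 - 2 * d)"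
        using subgaussian_survival[OF P d] by simp
    qed auto
  }
qed

end
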